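(* The proportion of weighted (unrooted) trees of total weight $n$ that are weighted cospectral to another (non-isomorphic) weighted tree approaches $1$ as $n\to\infty$.
   Context: A weighted tree is a finite unrooted tree in which each vertex is assigned a positive integer weight. Its total weight is the sum of the weights of all its vertices. Weighted trees are counted up to weight-preserving isomorphism. For a weighted tree $W$ with adjacency matrix $A(W)$ (a $0/1$ matrix) and vertex weights $w(i)$, let $I^*=I^*(x)$ be the diagonal matrix indexed by the vertices of $W$ whose $ii$-entry is $x^{w(i)}$, with $x$ an indeterminate. The weighted characteristic polynomial of $W$ is $\phi^*(W)=\phi^*(W,x)=\det(I^*(x)-A(W))$. Two weighted trees are weighted cospectral if they have the same weighted characteristic polynomial. *)

theory Defs
  imports Complex_Main "Jordan_Normal_Form.Determinant"
begin

text \<open>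
  A vertex-weighted graph on the vertex set \<open>{0..<k}\<close>: the number of vertices \<open>k\<close> is the length of
  the list of weights, vertex \<open>i\<close> has weight \<open>weights G ! i\<close>, and edges are unordered pairs.  Every
  finite weighted graph is isomorphic to one of this form, so nothing is lost when counting up to
  isomorphism.
\<close>

record weighted_graph =
  weights :: "nat list"
  edges :: "nat set set"

definition num_verts :: "weighted_graph \<Rightarrow> nat" where
  "num_verts G = length (weights G)"

definition verts :: "weighted_graph \<Rightarrow> nat set" where
  "verts G = {0..<num_verts G}"

definition total_weight :: "weighted_graph \<Rightarrow> nat" where
  "total_weight G = (\<Sum>v\<in>verts G. weights G ! v)"

definition simple_graph :: "weighted_graph \<Rightarrow> bool" where
  "simple_graph G \<longleftrightarrow> (\<forall>e\<in>edges G. e \<subseteq> verts G \<and> card e = 2)"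

definition connected_graph :: "weighted_graph \<Rightarrow> bool" where
  "connected_graph G \<longleftrightarrow>
     verts G \<noteq> {} \<and> (\<forall>u\<in>verts G. \<forall>v\<in>verts G. (u, v) \<in> {(x, y). {x, y} \<in> edges G}\<^sup>*)"

text \<open>A cycle is given by the list of its (at least three, distinct) vertices in cyclic order.\<close>

definition is_cycle :: "weighted_graph \<Rightarrow> nat list \<Rightarrow> bool" where
  "is_cycle G c \<longleftrightarrow> 3 \<le> length c \<and> distinct c \<and>
     (\<forall>i<length c. {c ! i, c ! (Suc i mod length c)} \<in> edges G)"

definition weighted_tree :: "weighted_graph \<Rightarrow> bool" where
  "weighted_tree G \<longleftrightarrow> simple_graph G \<and> connected_graph G \<and> (\<nexists>c. is_cycle G c) \<and>
     (\<forall>v\<in>verts G. 0 < weights G ! v)"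

definition weighted_iso :: "weighted_graph \<Rightarrow> weighted_graph \<Rightarrow> bool" where
  "weighted_iso G H \<longleftrightarrow> (\<exists>f. bij_betw f (verts G) (verts H) \<and>
     (\<forall>u\<in>verts G. \<forall>v\<in>verts G. {u, v} \<in> edges G \<longleftrightarrow> {f u, f v} \<in> edges H) \<and>
     (\<forall>v\<in>verts G. weights H ! f v = weights G ! v))"

definition adjacency_matrix :: "weighted_graph \<Rightarrow> int poly mat" where
  "adjacency_matrix G =
     mat (num_verts G) (num_verts G) (\<lambda>(i, j). if {i, j} \<in> edges G then 1 else 0)"

definition weight_matrix :: "weighted_graph \<Rightarrow> int poly mat" where
  "weight_matrix G =
     mat (num_verts G) (num_verts G) (\<lambda>(i, j). if i = j then monom 1 (weights G ! i) else 0)"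

definition weighted_char_poly :: "weighted_graph \<Rightarrow> int poly" where
  "weighted_char_poly G = det (weight_matrix G - adjacency_matrix G)"

definition weighted_cospectral :: "weighted_graph \<Rightarrow> weighted_graph \<Rightarrow> bool" where
  "weighted_cospectral G H \<longleftrightarrow> weighted_char_poly G = weighted_char_poly H"

definition has_cospectral_mate :: "weighted_graph \<Rightarrow> bool" where
  "has_cospectral_mate T \<longleftrightarrow>
     (\<exists>U. weighted_tree U \<and> \<not> weighted_iso T U \<and> weighted_cospectral T U)"

definition tree_iso_rel :: "(weighted_graph \<times> weighted_graph) set" where
  "tree_iso_rel = {(T, U). weighted_tree T \<and> weighted_tree U \<and> weighted_iso T U}"

text \<open>The isomorphism classes of weighted trees of total weight \<open>n\<close>.\<close>

definition tree_classes :: "nat \<Rightarrow> weighted_graph set set" where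
  "tree_classes n = {T. weighted_tree T \<and> total_weight T = n} // tree_iso_rel"

text \<open>
  The next facts confirm that \<open>weighted_iso\<close> is an equivalence and that \<open>tree_classes n\<close> is finite
  and, for positive \<open>n\<close>, nonempty, so that cardinalities and quotients of them are meaningful.
\<close>

lemma weighted_iso_refl: "weighted_iso G G"
  unfolding weighted_iso_def by (rule exI[of _ id]) auto

lemma weighted_iso_sym:
  assumes "weighted_iso G H"
  shows "weighted_iso H G"
proof -
  obtain f where f: "bij_betw f (verts G) (verts H)"
    and e: "\<And>u v. u \<in> verts G \<Longrightarrow> v \<in> verts G \<Longrightarrow> {u, v} \<in> edges G \<longleftrightarrow> {f u, f v} \<in> edges H"
    and w: "\<And>v. v \<in> verts G \<Longrightarrow> weights H ! f v = weights G ! v"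
    using assms unfolding weighted_iso_def by blast
  define g where "g = inv_into (verts G) f"
  have g: "bij_betw g (verts H) (verts G)"
    unfolding g_def using f by (rule bij_betw_inv_into)
  have gv: "g v \<in> verts G" "f (g v) = v" if "v \<in> verts H" for v
    using that g f unfolding g_def by (auto simp: bij_betw_def intro: inv_into_into f_inv_into_f)
  have "{u, v} \<in> edges H \<longleftrightarrow> {g u, g v} \<in> edges G" if "u \<in> verts H" "v \<in> verts H" for u v
    using e[OF gv(1)[OF that(1)] gv(1)[OF that(2)]] gv(2) that by simp
  moreover have "weights G ! g v = weights H ! v" if "v \<in> verts H" for v
    using w[OF gv(1)[OF that]] gv(2)[OF that] by simp
  ultimately show ?thesis
    unfolding weighted_iso_def using g by blast
qed

lemma weighted_iso_trans:
  assumes "weighted_iso G H" "weighted_iso H K"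
  shows "weighted_iso G K"
proof -
  obtain f where f: "bij_betw f (verts G) (verts H)"
    "\<And>u v. u \<in> verts G \<Longrightarrow> v \<in> verts G \<Longrightarrow> {u, v} \<in> edges G \<longleftrightarrow> {f u, f v} \<in> edges H"
    "\<And>v. v \<in> verts G \<Longrightarrow> weights H ! f v = weights G ! v"
    using assms(1) unfolding weighted_iso_def by blast
  obtain g where g: "bij_betw g (verts H) (verts K)"
    "\<And>u v. u \<in> verts H \<Longrightarrow> v \<in> verts H \<Longrightarrow> {u, v} \<in> edges H \<longleftrightarrow> {g u, g v} \<in> edges K"
    "\<And>v. v \<in> verts H \<Longrightarrow> weights K ! g v = weights H ! v"
    using assms(2) unfolding weighted_iso_def by blast
  have "f v \<in> verts H" if "v \<in> verts G" for v
    using f(1) that by (auto simp: bij_betw_def)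
  then show ?thesis
    unfolding weighted_iso_def
    by (intro exI[of _ "g \<circ> f"] conjI bij_betw_trans[OF f(1) g(1)]) (simp_all add: f(2,3) g(2,3))
qed

lemma equiv_tree_iso_rel: "equiv {T. weighted_tree T} tree_iso_rel"
  by (rule equivI)
    (auto simp: refl_on_def sym_def trans_def tree_iso_rel_def
      intro: weighted_iso_refl weighted_iso_sym weighted_iso_trans)

lemma finite_weighted_trees: "finite {T. weighted_tree T \<and> total_weight T = n}" (is "finite ?S")
proof -
  define B where "B = {ws. set ws \<subseteq> {0..n} \<and> length ws \<le> n} \<times> Pow (Pow {0..<n})"
  have "(weights T, edges T) \<in> B" if T: "weighted_tree T" "total_weight T = n" for T
  proof -
    have n: "n = (\<Sum>v<length (weights T). weights T ! v)"
      using T(2) by (simp add: total_weight_def verts_def num_verts_def lessThan_atLeast0)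
    have pos: "1 \<le> weights T ! v" if "v < length (weights T)" for v
      using T(1) that by (auto simp: weighted_tree_def verts_def num_verts_def Suc_le_eq)
    have "(\<Sum>v<length (weights T). 1) \<le> (\<Sum>v<length (weights T). weights T ! v)"
      by (rule sum_mono) (simp add: pos[simplified])
    then have len: "length (weights T) \<le> n"
      using n by simp
    have "weights T ! v \<le> n" if "v < length (weights T)" for v
      unfolding n by (rule member_le_sum) (use that in auto)
    then have "set (weights T) \<subseteq> {0..n}"
      by (auto simp: in_set_conv_nth)
    moreover have "e \<subseteq> {0..<n}" if "e \<in> edges T" for e
    proof -
      have "e \<subseteq> {0..<length (weights T)}"
        using T(1) that by (simp add: weighted_tree_def simple_graph_def verts_def num_verts_def)
      then show ?thesis
        using len by force
    qed
    then have "edges T \<subseteq> Pow {0..<n}"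
      by blast
    ultimately show ?thesis
      using len by (simp add: B_def)
  qed
  then have "(\<lambda>T. (weights T, edges T)) ` ?S \<subseteq> B"
    by blast
  moreover have "finite B"
    unfolding B_def by (intro finite_cartesian_product finite_lists_length_le) auto
  ultimately have "finite ((\<lambda>T. (weights T, edges T)) ` ?S)"
    by (rule finite_subset)
  moreover have "inj_on (\<lambda>T. (weights T, edges T)) ?S"
    by (rule inj_onI) (simp add: weighted_graph.equality)
  ultimately show ?thesis
    by (rule finite_imageD)
qed

lemma finite_tree_classes: "finite (tree_classes n)"
  unfolding tree_classes_def quotient_def using finite_weighted_trees by simp

lemma tree_classes_nonempty:
  assumes "0 < n"
  shows "tree_classes n \<noteq> {}"
proof -
  define T where "T = \<lparr>weights = [n], edges = {}\<rparr>"
  have "\<not> is_cycle T c" for c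
    by (cases c) (auto simp: is_cycle_def T_def)
  then have "weighted_tree T" "total_weight T = n"
    using assms by (auto simp: weighted_tree_def simple_graph_def connected_graph_def verts_def
        num_verts_def total_weight_def T_def)
  then show ?thesis
    by (auto simp: tree_classes_def quotient_def)
qed

end

theory Submission
  imports "HOL-Library.Multiset" "HOL-Analysis.Uniform_Limit" Defs
begin

text \<open>
  Rooted weighted trees with weight enumerator \<open>R(x)\<close> satisfy Polya's equation
  \<open>R(x) = x/(1-x) exp(R(x) + R(x\<^sup>2)/2 + \<dots>)\<close>.  Trees that do not contain a fixed rooted tree \<open>L\<close>
  as a branch satisfy the same equation with the term \<open>x^(wt L)\<close> subtracted on the right.  The equation
  and \<open>R exp(-R) \<le> 1/e\<close> bound \<open>x/(1-x) exp(R(x\<^sup>2)/2 + \<dots>)\<close> by \<open>1/e\<close> up to the radius of convergence;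
  this quantity is continuous there, and the subtracted term leaves enough room for the enumerator of the
  trees avoiding \<open>L\<close> to stay bounded by \<open>1\<close> at a larger point.  So almost every tree contains \<open>L\<close>, even
  after the loss of a factor \<open>n\<close> in passing from rooted to unrooted trees.

  Joining two rooted trees by an edge between their roots acts on the pair formed by the characteristic
  polynomial and that of the tree without its root.  Take for \<open>L\<close> a tree of weight 21 such that another
  tree \<open>L'\<close> with different vertex weights has the same pair.  Replacing a branch \<open>L\<close> by \<open>L'\<close> then
  produces a cospectral mate.
\<close>

subsection \<open>Rooted trees and their enumerators\<close>

text \<open>The value of \<open>R\<close> at its radius of convergence \<rho> stays unknown
  throughout, so all estimates are inequalities between finite partial sums. The unknown value is
  eliminated because \<open>y exp (-y)\<close> has its maximum at \<open>y = 1\<close>: at every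
  point of convergence, \<open>f x = x/(1-x) exp (1 + R(x^2)/2 + ...)\<close> is at most 1. The
  exponent involves \<open>R\<close> only at \<open>x^2\<close> and higher powers, and \<rho> < 1
  makes \<open>x^2\<close> smaller than \<rho> even for \<open>x\<close> slightly beyond \<rho>;
  this is why \<open>f\<close> can be followed past \<rho>. Where \<open>f x\<close> is at most
  \<open>1 + x ^ wt L\<close>, the bound 1 for trees avoiding \<open>L\<close> reproduces itself
  from one weight to the next. The comparison of proportions needs a lower bound on every
  coefficient of \<open>R\<close>, whereas divergence gives it only along a subsequence; gluing
  trees together closes this gap. On the graph side the difficulty is to certify that the mate is
  not isomorphic to the original inside an arbitrary host tree. The multiset of vertex weights is an
  invariant whose change under the exchange is independent of the host, hence the demand that
  \<open>L\<close> and \<open>L'\<close> have different weights.\<close>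

datatype rtree = Node nat "rtree multiset"

text \<open>A label \<open>k\<close> stands for weight \<open>Suc k\<close>, which builds positivity
  of the weights into the datatype. As the children form a multiset, equality of terms is
  isomorphism of rooted weighted trees.\<close>

primrec wt :: "rtree \<Rightarrow> nat" where
  "wt (Node k M) = Suc k + sum_mset (image_mset wt M)"

primrec subtrees :: "rtree \<Rightarrow> rtree set" where
  "subtrees (Node k M) = insert (Node k M) (\<Union> (set_mset (image_mset subtrees M)))"

primrec children :: "rtree \<Rightarrow> rtree multiset" where
  "children (Node k M) = M"

lemma wt_pos [simp]: "0 < wt t"
  by (cases t) simp

lemma wt_neq_0 [simp]: "wt t \<noteq> 0"
  by (cases t) simp

lemma wt_child_less:
  assumes "s \<in># M"
  shows "wt s < wt (Node k M)"
  using assms by (auto dest!: multi_member_split)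

lemma wt_children_less: "s \<in># children t \<Longrightarrow> wt s < wt t"
  by (cases t) (simp add: wt_child_less del: wt.simps)

text \<open>Boxes exhaust the trees with children in \<open>F\<close>, and their weight enumerators factorise.\<close>

definition tree_box :: "rtree set \<Rightarrow> nat \<Rightarrow> rtree set" where
  "tree_box F B = (\<lambda>(k, g). Node k (\<Sum>s\<in>F. replicate_mset (g s) s)) ` ({..<B} \<times> (F \<rightarrow>\<^sub>E {..<B}))"

lemma count_sum_replicate:
  assumes "finite F"
  shows "count (\<Sum>s\<in>F. replicate_mset (g s) s) x = (if x \<in> F then g x else 0)"
  using assms by (induction F rule: finite_induct) auto

lemma wt_Node_sum_replicate:
  assumes "finite F"
  shows "wt (Node k (\<Sum>s\<in>F. replicate_mset (g s) s)) = Suc k + (\<Sum>s\<in>F. g s * wt s)"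
  using assms by (induction F rule: finite_induct) auto

lemma finite_tree_box: "finite F \<Longrightarrow> finite (tree_box F B)"
  unfolding tree_box_def by (intro finite_imageI finite_cartesian_product finite_PiE) auto

lemma inj_on_tree_box:
  assumes "finite F"
  shows "inj_on (\<lambda>(k, g). Node k (\<Sum>s\<in>F. replicate_mset (g s) s)) ({..<B} \<times> (F \<rightarrow>\<^sub>E {..<B}))"
proof (rule inj_onI)
  fix p q
  assume p: "p \<in> {..<B} \<times> (F \<rightarrow>\<^sub>E {..<B})" and q: "q \<in> {..<B} \<times> (F \<rightarrow>\<^sub>E {..<B})"
    and eq: "(\<lambda>(k, g). Node k (\<Sum>s\<in>F. replicate_mset (g s) s)) p
      = (\<lambda>(k, g). Node k (\<Sum>s\<in>F. replicate_mset (g s) s)) q"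
  have M: "(\<Sum>s\<in>F. replicate_mset (snd p s) s) = (\<Sum>s\<in>F. replicate_mset (snd q s) s)"
    using eq by (simp add: case_prod_unfold)
  have "snd p s = snd q s" if "s \<in> F" for s
    using arg_cong[OF M, of "\<lambda>M. count M s"] that by (simp add: count_sum_replicate[OF assms])
  then have "snd p = snd q"
    using p q by (intro PiE_ext[of _ F "\<lambda>_. {..<B}"]) auto
  then show "p = q"
    using eq by (auto simp: case_prod_unfold prod_eq_iff)
qed

text \<open>A truncated Euler product: the label and the multiplicities of the children are chosen
  independently, and each contributes a finite geometric sum. Truncation keeps the identity free of
  convergence questions.\<close>

lemma tree_box_enumerator:
  fixes x :: real
  assumes "finite F"
  shows "(\<Sum>t\<in>tree_box F B. x ^ wt t) = x * (\<Sum>k<B. x ^ k) * (\<Prod>s\<in>F. \<Sum>j<B. (x ^ wt s) ^ j)"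
proof -
  have "(\<Sum>t\<in>tree_box F B. x ^ wt t)
      = (\<Sum>(k, g)\<in>{..<B} \<times> (F \<rightarrow>\<^sub>E {..<B}). x ^ wt (Node k (\<Sum>s\<in>F. replicate_mset (g s) s)))"
    unfolding tree_box_def by (subst sum.reindex[OF inj_on_tree_box[OF assms]]) (simp add: case_prod_unfold)
  also have "\<dots> = (\<Sum>(k, g)\<in>{..<B} \<times> (F \<rightarrow>\<^sub>E {..<B}). x * x ^ k * (\<Prod>s\<in>F. (x ^ wt s) ^ g s))"
    unfolding wt_Node_sum_replicate[OF assms]
    by (simp add: power_add power_sum mult.assoc flip: power_mult mult.commute[of "wt _"])
  also have "\<dots> = (\<Sum>k<B. x * x ^ k) * (\<Sum>g\<in>F \<rightarrow>\<^sub>E {..<B}. \<Prod>s\<in>F. (x ^ wt s) ^ g s)"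
    by (simp add: sum_product sum.cartesian_product)
  also have "(\<Sum>g\<in>F \<rightarrow>\<^sub>E {..<B}. \<Prod>s\<in>F. (x ^ wt s) ^ g s) = (\<Prod>s\<in>F. \<Sum>j<B. (x ^ wt s) ^ j)"
    by (simp add: prod_sum_PiE assms)
  finally show ?thesis
    by (simp add: sum_distrib_left)
qed

lemma in_tree_box:
  assumes "finite F" "set_mset M \<subseteq> F" "k < B" "size M < B"
  shows "Node k M \<in> tree_box F B"
proof -
  have "(\<Sum>s\<in>F. replicate_mset (count M s) s) = M"
    using assms(2) by (intro multiset_eqI) (auto simp: count_sum_replicate[OF assms(1)] not_in_iff)
  moreover have "count M s < B" for s
    using count_le_size[of M s] assms(4) by simp
  ultimately show ?thesis
    unfolding tree_box_def using assms(3)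
    by (intro image_eqI[where x = "(k, restrict (count M) F)"]) (auto cong: sum.cong)
qed

lemma finite_subset_tree_box:
  assumes "finite F" "finite F'" "\<And>t. t \<in> F' \<Longrightarrow> set_mset (children t) \<subseteq> F"
  shows "\<exists>B. F' \<subseteq> tree_box F B"
proof -
  define b where "b t = (case t of Node k M \<Rightarrow> Suc (k + size M))" for t
  have "t \<in> tree_box F (\<Sum>t\<in>F'. b t)" if "t \<in> F'" for t
  proof -
    have "b t \<le> (\<Sum>t\<in>F'. b t)"
      using that assms(2) by (intro member_le_sum) auto
    then show ?thesis
      using assms(3)[OF that] by (cases t) (auto simp: b_def intro!: in_tree_box assms(1))
  qed
  then show ?thesis
    by blast
qed

section \<open>Polya's equation as two inequalities\<close>

lemma sum_power_le:
  fixes y :: real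
  assumes "0 \<le> y" "y < 1"
  shows "(\<Sum>j<B. y ^ j) \<le> 1 / (1 - y)"
  using sum_le_suminf[OF summable_geometric, of y "{..<B}"] suminf_geometric[of y] assms by simp

text \<open>The upper half of Polya's equation: the trees of \<open>F'\<close> lie in one large box,
  and replacing each finite geometric sum by its limit only increases the product.\<close>

lemma enumerator_le:
  fixes x :: real
  assumes "finite F" "finite F'" "\<And>t. t \<in> F' \<Longrightarrow> set_mset (children t) \<subseteq> F"
    and x: "0 < x" "x < 1"
  shows "(\<Sum>t\<in>F'. x ^ wt t) \<le> x / (1 - x) * (\<Prod>s\<in>F. 1 / (1 - x ^ wt s))"
proof -
  obtain B where B: "F' \<subseteq> tree_box F B"
    using finite_subset_tree_box[OF assms(1-3)] by blast
  have "(\<Sum>t\<in>F'. x ^ wt t) \<le> (\<Sum>t\<in>tree_box F B. x ^ wt t)"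
    using B x by (intro sum_mono2 finite_tree_box assms(1)) auto
  also have "\<dots> \<le> x * (1 / (1 - x)) * (\<Prod>s\<in>F. 1 / (1 - x ^ wt s))"
    unfolding tree_box_enumerator[OF assms(1)] using x
    by (intro mult_mono prod_mono sum_power_le conjI prod_nonneg sum_nonneg mult_nonneg_nonneg)
       (auto simp: power_Suc_less_one wt_pos power_less_one_iff)
  finally show ?thesis by simp
qed

text \<open>The lower half: the enumerators of growing boxes tend to the full product, while each
  box is a finite set of trees and hence bounded by \<open>C\<close>.\<close>

lemma enumerator_ge:
  fixes x :: real
  assumes "finite F" and x: "0 < x" "x < 1" and le: "\<And>F'. finite F' \<Longrightarrow> (\<Sum>t\<in>F'. x ^ wt t) \<le> C"
  shows "x / (1 - x) * (\<Prod>s\<in>F. 1 / (1 - x ^ wt s)) \<le> C"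
proof -
  have geo: "(\<lambda>B. \<Sum>j<B. y ^ j) \<longlonglongrightarrow> 1 / (1 - y)" if "0 < y" "y < 1" for y :: real
    using geometric_sums[of y] that by (simp add: sums_def)
  have "(\<lambda>B. x * (\<Sum>k<B. x ^ k) * (\<Prod>s\<in>F. \<Sum>j<B. (x ^ wt s) ^ j))
      \<longlonglongrightarrow> x * (1 / (1 - x)) * (\<Prod>s\<in>F. 1 / (1 - x ^ wt s))"
    using x by (intro tendsto_intros geo) (auto simp: wt_pos power_less_one_iff)
  moreover have "x * (\<Sum>k<B. x ^ k) * (\<Prod>s\<in>F. \<Sum>j<B. (x ^ wt s) ^ j) \<le> C" for B
    using le[OF finite_tree_box[OF assms(1)]] by (simp add: tree_box_enumerator[OF assms(1)])
  ultimately show ?thesis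
    by (intro LIMSEQ_le_const2[where a = C]) auto
qed

lemma finite_wt_le: "finite {t. wt t \<le> n}"
proof (induction n)
  case 0
  show ?case by simp
next
  case (Suc n)
  let ?S = "{t. wt t \<le> Suc n}"
  \<comment> \<open>Once 1 is spent on the root, a weight of at most \<open>n\<close> is left for
    the label and the children, and each child weighs at least 1; so the label and the number of
    children are at most \<open>n\<close>.\<close>
  have "t \<in> tree_box {t. wt t \<le> n} (Suc (Suc n))" if "wt t \<le> Suc n" for t
  proof (cases t)
    case (Node k M)
    have "size M \<le> sum_mset (image_mset wt M)"
    proof (induction M)
      case (add s M)
      have "Suc 0 \<le> wt s"
        by (simp add: Suc_le_eq)
      from add_mono[OF this add] show ?case by simp
    qed simp
    moreover have "set_mset M \<subseteq> {t. wt t \<le> n}"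
      using wt_child_less[of _ M k] that Node by fastforce
    ultimately show ?thesis
      unfolding Node using that Node by (intro in_tree_box Suc) auto
  qed
  then show ?case
    by (intro finite_subset[OF _ finite_tree_box[OF Suc]]) auto
qed

definition cnt :: "rtree set \<Rightarrow> nat \<Rightarrow> nat" where
  "cnt S n = card {t \<in> S. wt t = n}"

lemma finite_wt_le_set: "finite {t \<in> S. wt t \<le> n}"
  by (rule finite_subset[OF _ finite_wt_le[of n]]) auto

lemma finite_wt_eq: "finite {t \<in> S. wt t = n}"
  by (rule finite_subset[OF _ finite_wt_le[of n]]) auto

lemma cnt_0 [simp]: "cnt S 0 = 0"
  by (simp add: cnt_def)

lemma cnt_UNIV_pos: "0 < n \<Longrightarrow> 0 < cnt UNIV n"
  unfolding cnt_def using finite_wt_eq[of UNIV n]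
  by (auto simp: card_gt_0_iff intro: exI[of _ "Node (n - 1) {#}"])

lemma sum_over_weights:
  fixes f :: "nat \<Rightarrow> real"
  shows "(\<Sum>t\<in>{t \<in> S. wt t \<le> N}. f (wt t)) = (\<Sum>n\<le>N. real (cnt S n) * f n)"
proof -
  have "(\<Sum>t\<in>{t \<in> S. wt t \<le> N}. f (wt t))
      = (\<Sum>n\<le>N. \<Sum>t\<in>{t. t \<in> {t \<in> S. wt t \<le> N} \<and> wt t = n}. f (wt t))"
    by (rule sum.group[symmetric]) (auto intro: finite_wt_le_set)
  also have "\<dots> = (\<Sum>n\<le>N. \<Sum>t\<in>{t \<in> S. wt t = n}. f n)"
    by (intro sum.cong) auto
  finally show ?thesis
    by (simp add: cnt_def)
qed

text \<open>\<open>excess y = y\<^sup>2/2 + y\<^sup>3/3 + \<dots>\<close>, so summing \<open>excess (x ^ wt t)\<close> over all trees gives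
  \<open>R(x\<^sup>2)/2 + R(x\<^sup>3)/3 + \<dots>\<close>.\<close>

definition excess :: "real \<Rightarrow> real" where
  "excess y = - ln (1 - y) - y"

lemma excess_nonneg: "0 \<le> y \<Longrightarrow> y < 1 \<Longrightarrow> 0 \<le> excess y"
  using ln_le_minus_one[of "1 - y"] by (simp add: excess_def)

lemma excess_le: "0 \<le> y \<Longrightarrow> y \<le> 1 / 2 \<Longrightarrow> excess y \<le> 2 * y\<^sup>2"
  using ln_one_minus_pos_lower_bound[of y] by (simp add: excess_def)

lemma excess_0 [simp]: "excess 0 = 0"
  by (simp add: excess_def)

text \<open>Separates the linear term of \<open>- ln (1 - y)\<close> from the rest. The linear terms
  add up to the enumerator itself, which is tied to the radius of convergence; the rest is quadratic
  in \<open>y\<close> and can be controlled beyond it.\<close>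

lemma prod_eq_exp_excess:
  fixes x :: real
  assumes "finite F" "0 < x" "x < 1"
  shows "(\<Prod>s\<in>F. 1 / (1 - x ^ wt s)) = exp ((\<Sum>s\<in>F. excess (x ^ wt s)) + (\<Sum>s\<in>F. x ^ wt s))"
proof -
  have "1 / (1 - x ^ wt s) = exp (excess (x ^ wt s) + x ^ wt s)" for s
  proof -
    have "x ^ wt s < 1"
      using assms by (simp add: power_less_one_iff)
    then show ?thesis
      by (simp add: excess_def exp_minus inverse_eq_divide)
  qed
  then show ?thesis
    by (simp add: exp_sum assms(1) flip: sum.distrib)
qed

text \<open>Keeps the radius of convergence away from 0. At 1/10 the prefactor is 1/9 and each
  factor of the product is at most \<open>exp (10 / 9 * y)\<close>, so a bound 1 up to weight
  \<open>N\<close> gives \<open>exp 2 / 9\<close> up to \<open>Suc N\<close>, which is at most 1 by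
  \<open>exp 1 \<le> 3\<close>.\<close>

lemma enumerator_bounded_at_tenth: "(\<Sum>t\<in>{t. wt t \<le> N}. (1 / 10 :: real) ^ wt t) \<le> 1"
proof (induction N)
  case (Suc N)
  let ?x = "1 / 10 :: real" and ?F = "{t. wt t \<le> N}"
  have pow: "?x ^ wt s \<le> ?x" for s
    using power_decreasing[of 1 "wt s" ?x] by (simp add: Suc_le_eq)
  have "(\<Sum>t\<in>{t. wt t \<le> Suc N}. ?x ^ wt t) \<le> ?x / (1 - ?x) * (\<Prod>s\<in>?F. 1 / (1 - ?x ^ wt s))"
  proof (rule enumerator_le)
    fix t assume "t \<in> {t. wt t \<le> Suc N}"
    then show "set_mset (children t) \<subseteq> ?F"
      using wt_children_less[of _ t] by fastforce
  qed (auto simp: finite_wt_le)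
  also have "(\<Prod>s\<in>?F. 1 / (1 - ?x ^ wt s)) \<le> (\<Prod>s\<in>?F. exp (10 / 9 * ?x ^ wt s))"
  proof (intro prod_mono conjI)
    fix s
    let ?y = "?x ^ wt s"
    have "1 / (1 - ?y) = 1 + ?y / (1 - ?y)"
      using pow[of s] by (simp add: field_simps)
    also have "\<dots> \<le> 1 + 10 / 9 * ?y"
      using pow[of s] by (simp add: field_simps)
    also have "\<dots> \<le> exp (10 / 9 * ?y)"
      by (rule exp_ge_add_one_self)
    finally show "1 / (1 - ?y) \<le> exp (10 / 9 * ?y)" .
    show "0 \<le> 1 / (1 - ?y)"
      using pow[of s] by simp
  qed
  also have "\<dots> = exp (10 / 9 * (\<Sum>s\<in>?F. ?x ^ wt s))"
    by (simp add: exp_sum finite_wt_le sum_distrib_left)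
  also have "\<dots> \<le> exp 2"
    using Suc by simp
  also have "exp (2 :: real) = exp 1 * exp 1"
    by (simp flip: exp_add)
  also have "\<dots> \<le> 3 * 3"
    by (intro mult_mono exp_le) auto
  finally show ?case by simp
qed simp

text \<open>The product over the members of \<open>S\<close> also accounts for a tree outside
  \<open>S\<close> of weight \<open>wt L\<close>. Its term \<open>x ^ wt L\<close> can be moved to
  the left, and this is exactly the amount by which \<open>bound\<close> allows the right-hand side
  to exceed 1.\<close>

lemma enumerator_bounded_of_omission:
  fixes x :: real
  assumes closed: "\<And>t. t \<in> S \<Longrightarrow> set_mset (children t) \<subseteq> S"
    and L: "L \<notin> S" "set_mset (children L) \<subseteq> S"
    and x: "0 < x" "x < 1"
    and bound: "\<And>N. x / (1 - x) * exp (\<Sum>s\<in>{s \<in> S. wt s \<le> N}. excess (x ^ wt s)) * exp 1 \<le> 1 + x ^ wt L"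
  shows "(\<Sum>t\<in>{t \<in> S. wt t \<le> N}. x ^ wt t) \<le> 1"
proof (induction N)
  case (Suc N)
  let ?F = "{t \<in> S. wt t \<le> N}" and ?F' = "{t \<in> S. wt t \<le> Suc N}"
  \<comment> \<open>a tree that the product over \<open>?F\<close> counts but the left-hand side does not\<close>
  define t0 where "t0 = (if wt L \<le> Suc N then L else Node (wt L - 1) {#})"
  have "wt (Node (wt L - 1) {#}) = wt L"
    using wt_pos[of L] by simp
  then have t0: "t0 \<notin> ?F'" "wt t0 = wt L"
    using L(1) by (auto simp: t0_def simp del: wt_pos)
  have "(\<Sum>t\<in>?F'. x ^ wt t) + x ^ wt L = (\<Sum>t\<in>insert t0 ?F'. x ^ wt t)"
    using t0 finite_wt_le_set by simp
  also have "\<dots> \<le> x / (1 - x) * (\<Prod>s\<in>?F. 1 / (1 - x ^ wt s))"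
  proof (rule enumerator_le)
    fix t assume t: "t \<in> insert t0 ?F'"
    have wt_le: "wt s \<le> N" if "s \<in># children t" "wt t \<le> Suc N" for s t
      using wt_children_less[OF that(1)] that(2) by linarith
    show "set_mset (children t) \<subseteq> ?F"
    proof (cases "t = t0")
      case True
      then show ?thesis
        using L wt_le[of _ L] by (auto simp: t0_def)
    next
      case False
      then show ?thesis
        using closed t wt_le[of _ t] by auto
    qed
  qed (use x finite_wt_le_set in auto)
  also have "\<dots> = x / (1 - x) * exp (\<Sum>s\<in>?F. excess (x ^ wt s)) * exp (\<Sum>s\<in>?F. x ^ wt s)"
    by (simp add: prod_eq_exp_excess finite_wt_le_set x exp_add)
  also have "\<dots> \<le> x / (1 - x) * exp (\<Sum>s\<in>?F. excess (x ^ wt s)) * exp 1"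
    using Suc x by (intro mult_left_mono) auto
  also have "\<dots> \<le> 1 + x ^ wt L"
    by (rule bound)
  finally show ?case by simp
qed simp

lemma enumerator_functional_bound:
  fixes x :: real
  assumes x: "0 < x" "x < 1" and summ: "summable (\<lambda>n. real (cnt UNIV n) * x ^ n)"
  shows "x / (1 - x) * exp (\<Sum>n\<le>N. real (cnt UNIV n) * excess (x ^ n)) * exp 1 \<le> 1"
proof -
  define K where "K N = (\<Sum>n\<le>N. real (cnt UNIV n) * excess (x ^ n))" for N
  define G where "G N = (\<Sum>n\<le>N. real (cnt UNIV n) * x ^ n)" for N
  define C where "C = (\<Sum>n. real (cnt UNIV n) * x ^ n)"
  have lim: "G \<longlonglongrightarrow> C"
    using summable_LIMSEQ'[OF summ] unfolding G_def C_def .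
  have GC: "G M \<le> C" for M
    unfolding G_def C_def using x by (intro sum_le_suminf summ) auto
  have le: "(\<Sum>t\<in>F'. x ^ wt t) \<le> C" if "finite F'" for F'
  proof -
    obtain M where M: "\<forall>t\<in>F'. wt t \<le> M"
      using finite_nat_set_iff_bounded_le[of "wt ` F'"] \<open>finite F'\<close> by auto
    then have "(\<Sum>t\<in>F'. x ^ wt t) \<le> (\<Sum>t\<in>{t \<in> UNIV. wt t \<le> M}. x ^ wt t)"
      using x by (intro sum_mono2 finite_wt_le_set) auto
    then show ?thesis
      using GC[of M] sum_over_weights[of "\<lambda>n. x ^ n" UNIV M] by (simp add: G_def)
  qed
  \<comment> \<open>Two cut-offs: \<open>N\<close> stays fixed while \<open>M\<close> tends to
    infinity, so that \<open>G M\<close> can be replaced by its limit \<open>C\<close> before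
    anything is known about the convergence of \<open>K\<close>.\<close>
  have "x / (1 - x) * exp (K N + G M) \<le> C" if "N \<le> M" for M
  proof -
    have "x / (1 - x) * (\<Prod>s\<in>{s \<in> UNIV. wt s \<le> M}. 1 / (1 - x ^ wt s)) \<le> C"
      using le by (intro enumerator_ge finite_wt_le_set x)
    then have "x / (1 - x) * exp (K M + G M) \<le> C"
      unfolding prod_eq_exp_excess[OF finite_wt_le_set x] K_def G_def
        sum_over_weights[of "\<lambda>n. x ^ n" UNIV M] sum_over_weights[of "\<lambda>n. excess (x ^ n)" UNIV M] .
    moreover have "K N \<le> K M"
      unfolding K_def
    proof (rule sum_mono2)
      fix n assume "n \<in> {..M} - {..N}"
      then have "x ^ n < 1"
        using x by (simp add: power_less_one_iff)
      then show "0 \<le> real (cnt UNIV n) * excess (x ^ n)"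
        using x by (intro mult_nonneg_nonneg excess_nonneg) auto
    qed (use that in auto)
    then have "x / (1 - x) * exp (K N + G M) \<le> x / (1 - x) * exp (K M + G M)"
      using x by (intro mult_left_mono) auto
    ultimately show ?thesis
      by linarith
  qed
  then have "x / (1 - x) * exp (K N + C) \<le> C"
    by (intro LIMSEQ_le_const2[OF tendsto_mult_left[OF tendsto_exp[OF tendsto_add[OF tendsto_const lim]]]])
       auto
  \<comment> \<open>This is \<open>y exp (-y) \<le> exp (-1)\<close> at \<open>y = C\<close>; it
    lets the unknown value \<open>C\<close> cancel.\<close>
  also have "C \<le> exp (C - 1)"
    using exp_ge_add_one_self[of "C - 1"] by simp
  finally have "x / (1 - x) * exp (K N) * exp C \<le> exp C / exp 1"
    by (simp add: exp_add exp_diff mult.assoc)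
  then have "x / (1 - x) * exp (K N) * exp 1 * exp C \<le> 1 * exp C"
    by (simp add: field_simps)
  then have "x / (1 - x) * exp (K N) * exp 1 \<le> 1"
    by (rule mult_right_le_imp_le) simp
  then show ?thesis
    unfolding K_def .
qed

section \<open>Coefficient growth, radius of convergence and the exponential gap\<close>

lemma cnt_UNIV_supermultiplicative: "cnt UNIV m * cnt UNIV n \<le> cnt UNIV (m + n + 4)"
proof -
  \<comment> \<open>The two new nodes below the root have weights 1 and 2 and mark which tree is
    \<open>a\<close> and which is \<open>b\<close>; otherwise a multiset of children would forget
    the order. Together with the root they weigh 4.\<close>
  define f where "f = (\<lambda>(a, b). Node 0 {#Node 0 {#a#}, Node 1 {#b#}#})"
  have "inj f"
    by (auto simp: inj_def f_def add_eq_conv_ex)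
  moreover have "f ` ({t \<in> UNIV. wt t = m} \<times> {t \<in> UNIV. wt t = n}) \<subseteq> {t \<in> UNIV. wt t = m + n + 4}"
    by (auto simp: f_def)
  ultimately have "card ({t \<in> UNIV. wt t = m} \<times> {t \<in> UNIV. wt t = n}) \<le> card {t \<in> UNIV. wt t = m + n + 4}"
    by (intro card_inj_on_le[OF inj_on_subset[OF _ subset_UNIV]] finite_wt_eq)
  then show ?thesis
    by (simp add: cnt_def card_cartesian_product)
qed

text \<open>If \<open>cnt UNIV m * y ^ (m + 4) < 1\<close> held for every \<open>m\<close>,
  comparison with a geometric series of ratio \<open>x / y\<close> would yield convergence at
  \<open>x\<close>; so some \<open>m\<close> reaches 1. Gluing on trees of weight \<open>m\<close>
  carries the bound from \<open>n - p\<close> to \<open>n\<close> with \<open>p = m + 4\<close>, and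
  the coefficients up to \<open>p\<close> determine \<open>c\<close>.\<close>

lemma cnt_UNIV_ge:
  fixes x y :: real
  assumes x: "0 < x" "x < y" and div: "\<not> summable (\<lambda>n. real (cnt UNIV n) * x ^ n)"
  obtains c where "0 < c" "\<And>n. 0 < n \<Longrightarrow> c \<le> real (cnt UNIV n) * y ^ n"
proof -
  have y: "0 < y"
    using x by simp
  obtain m where m: "1 \<le> real (cnt UNIV m) * y ^ (m + 4)"
  proof (rule ccontr)
    assume "\<not> thesis"
    then have lt: "real (cnt UNIV m) * y ^ m * y ^ 4 < 1" for m
      using that[of m] by (fastforce simp: power_add mult.assoc not_le)
    have "summable (\<lambda>n. real (cnt UNIV n) * x ^ n)"
    proof (rule summable_comparison_test')
      show "summable (\<lambda>n. 1 / y ^ 4 * (x / y) ^ n)"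
        using x by (intro summable_mult summable_geometric) auto
      fix n
      have "real (cnt UNIV n) * x ^ n = (real (cnt UNIV n) * y ^ n) * (x / y) ^ n"
        using y by (simp add: power_divide)
      also have "\<dots> \<le> 1 / y ^ 4 * (x / y) ^ n"
        using lt[of n] x y by (intro mult_right_mono) (auto simp: field_simps)
      finally show "norm (real (cnt UNIV n) * x ^ n) \<le> 1 / y ^ 4 * (x / y) ^ n"
        using x by simp
    qed
    with div show False ..
  qed
  define p where "p = m + 4"
  define c where "c = Min ((\<lambda>n. real (cnt UNIV n) * y ^ n) ` {1..p})"
  have "0 < c"
    unfolding c_def using y cnt_UNIV_pos by (subst Min_gr_iff) (auto simp: p_def)
  moreover have "c \<le> real (cnt UNIV n) * y ^ n" if "0 < n" for n
    using that
  proof (induction n rule: less_induct)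
    case (less n)
    show ?case
    proof (cases "n \<le> p")
      case True
      then show ?thesis
        unfolding c_def using less.prems by (intro Min_le) auto
    next
      case False
      then have n: "n = m + (n - p) + 4" "0 < n - p" "n - p < n"
        by (auto simp: p_def)
      have "c \<le> real (cnt UNIV (n - p)) * y ^ (n - p)"
        using n(2,3) by (rule less.IH[rotated])
      also have "\<dots> \<le> (real (cnt UNIV m) * y ^ p) * (real (cnt UNIV (n - p)) * y ^ (n - p))"
        using mult_right_mono[OF m, of "real (cnt UNIV (n - p)) * y ^ (n - p)"] y by (simp add: p_def)
      also have "\<dots> = real (cnt UNIV m * cnt UNIV (n - p)) * y ^ (p + (n - p))"
        by (simp add: power_add)
      also have "\<dots> \<le> real (cnt UNIV n) * y ^ n"
      proof (rule mult_mono)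
        show "real (cnt UNIV m * cnt UNIV (n - p)) \<le> real (cnt UNIV n)"
          using cnt_UNIV_supermultiplicative[of m "n - p"] n(1) by (simp flip: of_nat_mult)
      qed (use y False in auto)
      finally show ?thesis .
    qed
  qed
  ultimately show thesis
    using that by blast
qed

text \<open>The radius is the supremum of the points of convergence in the open unit interval. The
  upper bound 1/3 later leaves room for a point above \<open>r\<close> whose square is below
  \<open>r\<close>.\<close>

lemma exists_radius_of_convergence:
  obtains r :: real where "1 / 10 \<le> r" "r \<le> 1 / 3"
    "\<And>x. 0 < x \<Longrightarrow> x < r \<Longrightarrow> summable (\<lambda>n. real (cnt UNIV n) * x ^ n)"
    "\<And>x. r < x \<Longrightarrow> x < 1 \<Longrightarrow> \<not> summable (\<lambda>n. real (cnt UNIV n) * x ^ n)"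
proof -
  define A where "A = {x :: real. 0 < x \<and> x < 1 \<and> summable (\<lambda>n. real (cnt UNIV n) * x ^ n)}"
  have third: "x \<le> 1 / 3" if "x \<in> A" for x
  proof -
    \<comment> \<open>With \<open>N = 0\<close> the exponent vanishes, as no tree has weight
      0.\<close>
    have "x / (1 - x) * exp 1 \<le> 1"
      using enumerator_functional_bound[of x 0] that by (simp add: A_def)
    moreover have "x / (1 - x) * 2 \<le> x / (1 - x) * exp 1"
      using that exp_ge_add_one_self[of 1] by (intro mult_left_mono) (auto simp: A_def)
    ultimately have "x / (1 - x) * 2 \<le> 1"
      by linarith
    then show ?thesis
      using that by (simp add: A_def field_simps)
  qed
  have tenth: "1 / 10 \<in> A"
  proof -
    have "summable (\<lambda>n. real (cnt UNIV n) * (1 / 10) ^ n)"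
    proof (rule bounded_imp_summable)
      fix N
      show "(\<Sum>n\<le>N. real (cnt UNIV n) * (1 / 10) ^ n) \<le> 1"
        using enumerator_bounded_at_tenth[of N] sum_over_weights[of "\<lambda>n. (1 / 10) ^ n" UNIV N] by simp
    qed auto
    then show ?thesis by (simp add: A_def)
  qed
  have bdd: "bdd_above A"
    unfolding bdd_above_def using third by blast
  show thesis
  proof (rule that[of "Sup A"])
    show "1 / 10 \<le> Sup A"
      using tenth bdd by (rule cSup_upper)
    show "Sup A \<le> 1 / 3"
      using tenth third by (intro cSup_least) auto
    show "summable (\<lambda>n. real (cnt UNIV n) * x ^ n)" if x: "0 < x" "x < Sup A" for x
    proof -
      obtain z where z: "z \<in> A" "x < z"
        using less_cSup_iff[of A x] x tenth bdd by auto
      show ?thesis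
      proof (rule summable_comparison_test')
        show "summable (\<lambda>n. real (cnt UNIV n) * z ^ n)"
          using z by (simp add: A_def)
        show "norm (real (cnt UNIV n) * x ^ n) \<le> real (cnt UNIV n) * z ^ n" for n
          using x z by (simp add: mult_left_mono power_mono)
      qed
    qed
    show "\<not> summable (\<lambda>n. real (cnt UNIV n) * x ^ n)" if "Sup A < x" "x < 1" for x
    proof
      assume "summable (\<lambda>n. real (cnt UNIV n) * x ^ n)"
      moreover have "0 < x"
        using that cSup_upper[OF tenth bdd] by linarith
      ultimately have "x \<in> A"
        using that by (simp add: A_def)
      then show False
        using cSup_upper[OF _ bdd, of x] that by simp
    qed
  qed
qed

text \<open>As \<open>excess y\<close> is at most \<open>2 * y\<^sup>2\<close>, twice the enumerator
  at \<open>z\<^sup>2\<close> dominates the series on the whole interval. So \<open>z\<close> may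
  lie beyond the radius of convergence while \<open>z\<^sup>2\<close> lies within it.\<close>

lemma continuous_on_total_excess:
  fixes z :: real
  assumes z: "0 < z" "z \<le> 1 / 2" and summ: "summable (\<lambda>n. real (cnt UNIV n) * (z\<^sup>2) ^ n)"
  shows "continuous_on {0..z} (\<lambda>x. \<Sum>n. real (cnt UNIV n) * excess (x ^ n))"
    and "x \<in> {0..z} \<Longrightarrow> summable (\<lambda>n. real (cnt UNIV n) * excess (x ^ n))"
proof -
  have half: "x ^ n \<le> 1 / 2" if "x \<in> {0..z}" "0 < n" for x n
    using power_decreasing[of 1 n x] that z by auto
  have le: "norm (real (cnt UNIV n) * excess (x ^ n)) \<le> 2 * (real (cnt UNIV n) * (z\<^sup>2) ^ n)"
    if "x \<in> {0..z}" for x n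
  proof (cases "n = 0")
    case False
    have "excess (x ^ n) \<le> 2 * (x ^ n)\<^sup>2"
      using half[OF that] False that by (intro excess_le) auto
    also have "(x ^ n)\<^sup>2 \<le> (z ^ n)\<^sup>2"
      using that by (intro power_mono) auto
    finally have "excess (x ^ n) \<le> 2 * (z\<^sup>2) ^ n"
      by (simp add: mult.commute flip: power_mult)
    moreover have "0 \<le> excess (x ^ n)"
      using half[OF that, of n] False that by (intro excess_nonneg) auto
    ultimately show ?thesis
      by (simp add: mult_left_mono mult.left_commute[of 2])
  qed simp
  show "summable (\<lambda>n. real (cnt UNIV n) * excess (x ^ n))" if "x \<in> {0..z}" for x
    using le[OF that] by (intro summable_comparison_test'[OF summable_mult[OF summ]])
  show "continuous_on {0..z} (\<lambda>x. \<Sum>n. real (cnt UNIV n) * excess (x ^ n))"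
  proof (rule uniform_limit_theorem)
    show "uniform_limit {0..z} (\<lambda>N x. \<Sum>n<N. real (cnt UNIV n) * excess (x ^ n))
        (\<lambda>x. \<Sum>n. real (cnt UNIV n) * excess (x ^ n)) sequentially"
      by (rule Weierstrass_m_test[OF le summable_mult[OF summ]])
    have "continuous_on {0..z} (\<lambda>x. real (cnt UNIV n) * excess (x ^ n))" for n
    proof (cases "n = 0")
      case False
      then have "x ^ n \<noteq> 1" if "x \<in> {0..z}" for x
        using half[OF that, of n] by force
      then show ?thesis
        unfolding excess_def by (intro continuous_intros) auto
    qed simp
    then show "\<forall>\<^sub>F N in sequentially. continuous_on {0..z} (\<lambda>x. \<Sum>n<N. real (cnt UNIV n) * excess (x ^ n))"
      by (intro always_eventually allI continuous_on_sum)
  qed simp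
qed

text \<open>The counts of all trees are at least of order \<open>(1 / r) ^ n\<close>, those of the
  trees avoiding \<open>L\<close> at most \<open>(1 / x) ^ n\<close>. The gap \<open>r < x\<close>
  is exponential and so outweighs any polynomial factor.\<close>

lemma omission_lowers_growth_rate:
  obtains r x :: real and c where "0 < r" "r < x" "x < 1"
    "0 < c" "\<And>n. 0 < n \<Longrightarrow> c \<le> real (cnt UNIV n) * r ^ n"
    "\<And>n. real (cnt {t. L \<notin> subtrees t} n) * x ^ n \<le> 1"
proof -
  obtain \<rho> :: real where \<rho>: "1 / 10 \<le> \<rho>" "\<rho> \<le> 1 / 3"
    and conv: "\<And>x. 0 < x \<Longrightarrow> x < \<rho> \<Longrightarrow> summable (\<lambda>n. real (cnt UNIV n) * x ^ n)"
    and div: "\<And>x. \<rho> < x \<Longrightarrow> x < 1 \<Longrightarrow> \<not> summable (\<lambda>n. real (cnt UNIV n) * x ^ n)"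
    by (rule exists_radius_of_convergence) blast
  \<comment> \<open>The point has to satisfy \<open>z > \<rho>\<close>,
    \<open>z\<^sup>2 < \<rho>\<close> and \<open>z \<le> 1 / 2\<close>; by
    \<open>\<rho> \<le> 1 / 3\<close> the factor 5/4 achieves all three.\<close>
  define z where "z = 5 / 4 * \<rho>"
  define K where "K x = (\<Sum>n. real (cnt UNIV n) * excess (x ^ n))" for x
  define f where "f x = x / (1 - x) * exp (K x) * exp 1" for x
  have z: "0 < z" "z \<le> 1 / 2" "\<rho> < z" "z < 1"
    using \<rho> by (auto simp: z_def)
  have "z\<^sup>2 = \<rho> * (25 / 16 * \<rho>)"
    by (simp add: z_def power2_eq_square)
  also have "\<dots> < \<rho> * 1"
    using \<rho> by (intro mult_strict_left_mono) auto
  finally have "summable (\<lambda>n. real (cnt UNIV n) * (z\<^sup>2) ^ n)"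
    using z by (intro conv) auto
  note K = continuous_on_total_excess[OF z(1,2) this]
  have partial_le: "(\<Sum>n\<in>I. real (cnt UNIV n) * excess (x ^ n)) \<le> K x"
    if "x \<in> {0..z}" "finite I" for x I
    unfolding K_def
  proof (rule sum_le_suminf[OF K(2)[OF that(1)] that(2)])
    fix n
    show "0 \<le> real (cnt UNIV n) * excess (x ^ n)"
    proof (cases "n = 0")
      case False
      then have "x ^ n < 1"
        using that z by (auto simp: power_less_one_iff)
      then show ?thesis
        using that by (intro mult_nonneg_nonneg excess_nonneg) auto
    qed simp
  qed
  have f_cont: "continuous_on {0..z} f"
  proof -
    have "continuous_on {0..z} K"
      unfolding K_def by (rule K(1))
    then show ?thesis
      unfolding f_def using z by (intro continuous_intros) auto
  qed
  have f_le: "f x \<le> 1" if "x \<in> {0<..<\<rho>}" for x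
  proof -
    have x: "0 < x" "x < 1" "x \<in> {0..z}"
      using that z by auto
    have "(\<lambda>N. \<Sum>n\<le>N. real (cnt UNIV n) * excess (x ^ n)) \<longlonglongrightarrow> K x"
      unfolding K_def by (rule summable_LIMSEQ'[OF K(2)[OF x(3)]])
    then have "(\<lambda>N. x / (1 - x) * exp (\<Sum>n\<le>N. real (cnt UNIV n) * excess (x ^ n)) * exp 1) \<longlonglongrightarrow> f x"
      unfolding f_def by (intro tendsto_intros)
    moreover have "x / (1 - x) * exp (\<Sum>n\<le>N. real (cnt UNIV n) * excess (x ^ n)) * exp 1 \<le> 1" for N
      using that by (intro enumerator_functional_bound x conv) auto
    ultimately show ?thesis
      by (intro LIMSEQ_le_const2) auto
  qed
  have cl: "closure {0<..<\<rho>} = {0..\<rho>}"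
    using \<rho> by (intro closure_greaterThanLessThan) auto
  have "continuous_on (closure {0<..<\<rho>}) f"
    using z(3) by (intro continuous_on_subset[OF f_cont]) (auto simp: cl)
  \<comment> \<open>Convergence of the enumerator is available only below \<rho>, so the bound is
    carried to \<rho> by continuity.\<close>
  then have "f \<rho> \<le> 1"
  proof (rule continuous_le_on_closure)
    show "\<rho> \<in> closure {0<..<\<rho>}"
      unfolding cl using \<rho> by simp
  qed (rule f_le)
  moreover have "0 < \<rho> ^ wt L"
    using \<rho> by simp
  ultimately have "f \<rho> - \<rho> ^ wt L < 1"
    by linarith
  moreover have "continuous_on {0..z} (\<lambda>x. f x - x ^ wt L)"
    by (intro continuous_intros f_cont)
  then have "((\<lambda>x. f x - x ^ wt L) \<longlongrightarrow> f \<rho> - \<rho> ^ wt L) (at \<rho> within {0..z})"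
    using \<rho> z by (auto simp: continuous_on_def)
  ultimately have "\<forall>\<^sub>F x in at \<rho> within {0..z}. f x - x ^ wt L < 1"
    by (intro order_tendstoD(2))
  then obtain d where d: "0 < d" "\<And>x. x \<in> {0..z} \<Longrightarrow> x \<noteq> \<rho> \<Longrightarrow> dist x \<rho> < d \<Longrightarrow> f x - x ^ wt L < 1"
    by (auto simp: eventually_at)
  define x where "x = min z (\<rho> + d / 2)"
  have x: "\<rho> < x" "x \<le> z" "0 < x" "x < 1" "x \<in> {0..z}"
    using \<rho> z d(1) by (auto simp: x_def)
  have "f x - x ^ wt L < 1"
    using x d(1) by (intro d(2)) (auto simp: x_def dist_real_def)
  then have fx: "x / (1 - x) * exp (K x) * exp 1 \<le> 1 + x ^ wt L"
    by (simp add: f_def)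
  define S where "S = {t. L \<notin> subtrees t}"
  have self: "t \<in> subtrees t" for t
    by (cases t) simp
  have child: "subtrees s \<subseteq> subtrees t" if "s \<in># children t" for s t
    using that by (cases t) auto
  have wt_sub: "wt s \<le> wt t" if "s \<in> subtrees t" for s t
    using that
  proof (induction t)
    case (Node k M)
    then show ?case
    proof (cases "s = Node k M")
      case False
      then obtain u where "u \<in># M" "s \<in> subtrees u"
        using Node.prems by auto
      then show ?thesis
        using Node.IH wt_child_less[of u M k] by (meson le_less_trans less_imp_le)
    qed simp
  qed
  have S_bound: "(\<Sum>t\<in>{t \<in> S. wt t \<le> N}. x ^ wt t) \<le> 1" for N
  proof (rule enumerator_bounded_of_omission)
    show "set_mset (children t) \<subseteq> S" if "t \<in> S" for t
      using that child by (auto simp: S_def)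
    show "L \<notin> S"
      using self by (simp add: S_def)
    show "set_mset (children L) \<subseteq> S"
    proof
      fix s assume "s \<in># children L"
      then show "s \<in> S"
        using wt_sub[of L s] wt_children_less[of s L] by (auto simp: S_def)
    qed
    show "x / (1 - x) * exp (\<Sum>s\<in>{s \<in> S. wt s \<le> N}. excess (x ^ wt s)) * exp 1 \<le> 1 + x ^ wt L" for N
    proof -
      have "(\<Sum>s\<in>{s \<in> S. wt s \<le> N}. excess (x ^ wt s)) \<le> (\<Sum>s\<in>{s \<in> UNIV. wt s \<le> N}. excess (x ^ wt s))"
        using x by (intro sum_mono2 finite_wt_le_set excess_nonneg) (auto simp: power_less_one_iff)
      also have "\<dots> = (\<Sum>n\<le>N. real (cnt UNIV n) * excess (x ^ n))"
        by (rule sum_over_weights)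
      also have "\<dots> \<le> K x"
        using x by (intro partial_le) auto
      finally have "x / (1 - x) * exp (\<Sum>s\<in>{s \<in> S. wt s \<le> N}. excess (x ^ wt s)) * exp 1
          \<le> x / (1 - x) * exp (K x) * exp 1"
        using x by (intro mult_right_mono mult_left_mono) auto
      then show ?thesis
        using fx by linarith
    qed
  qed (use x in auto)
  have "real (cnt S n) * x ^ n \<le> 1" for n
  proof -
    have "real (cnt S n) * x ^ n \<le> (\<Sum>k\<le>n. real (cnt S k) * x ^ k)"
      using x by (intro member_le_sum) auto
    then show ?thesis
      using S_bound[of n] sum_over_weights[of "\<lambda>n. x ^ n" S n] by simp
  qed
  then have upper: "real (cnt {t. L \<notin> subtrees t} n) * x ^ n \<le> 1" for n
    by (simp only: S_def)
  \<comment> \<open>Divergence holds strictly above \<rho>, and the lower bound on the coefficients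
    holds strictly above a point of divergence; hence two intermediate points between \<rho> and
    \<open>x\<close>.\<close>
  define y where "y = (\<rho> + x) / 2"
  define r where "r = (y + x) / 2"
  have y: "\<rho> < y" "y < r" "r < x"
    using x by (auto simp: y_def r_def)
  then have y': "0 < y" "0 < r" "y < 1"
    using \<rho> x by linarith+
  show thesis
  proof (rule cnt_UNIV_ge[OF y'(1) y(2) div[OF y(1) y'(3)]])
    fix c :: real
    assume "0 < c" "\<And>n. 0 < n \<Longrightarrow> c \<le> real (cnt UNIV n) * r ^ n"
    then show thesis
      using y y' x upper by (intro that[of r x c])
  qed
qed

theorem omission_negligible:
  "(\<lambda>n. real n * real (cnt {t. L \<notin> subtrees t} n) / real (cnt UNIV n)) \<longlonglongrightarrow> 0"
proof -
  obtain r x :: real and c where r: "0 < r" "r < x" "x < 1" and c: "0 < c"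
    and lower: "\<And>n. 0 < n \<Longrightarrow> c \<le> real (cnt UNIV n) * r ^ n"
    and upper: "\<And>n. real (cnt {t. L \<notin> subtrees t} n) * x ^ n \<le> 1"
    using omission_lowers_growth_rate[of L] by metis
  have lim: "(\<lambda>n. real n * (r / x) ^ n * (1 / c)) \<longlonglongrightarrow> 0 * (1 / c)"
    using r by (intro tendsto_mult_right powser_times_n_limit_0) auto
  have le: "norm (real n * real (cnt {t. L \<notin> subtrees t} n) / real (cnt UNIV n)) \<le> real n * (r / x) ^ n * (1 / c)"
    if n: "1 \<le> n" for n
  proof -
    let ?s = "real (cnt {t. L \<notin> subtrees t} n)" and ?u = "real (cnt UNIV n)"
    have "0 < x" "0 < ?u"
      using r n cnt_UNIV_pos by auto
    have "?s * c \<le> (1 / x ^ n) * (?u * r ^ n)"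
      using upper[of n] lower[of n] n c \<open>0 < x\<close> by (intro mult_mono) (auto simp: field_simps)
    then have "?s / ?u \<le> (r / x) ^ n * (1 / c)"
      using \<open>0 < ?u\<close> \<open>0 < x\<close> c by (simp add: field_simps power_divide)
    then show "norm (real n * ?s / ?u) \<le> real n * (r / x) ^ n * (1 / c)"
      using mult_left_mono[of "?s / ?u" "(r / x) ^ n * (1 / c)" "real n"] by (simp add: mult.assoc)
  qed
  have "\<forall>\<^sub>F n in sequentially.
      norm (real n * real (cnt {t. L \<notin> subtrees t} n) / real (cnt UNIV n)) \<le> real n * (r / x) ^ n * (1 / c)"
    using le by (rule eventually_sequentiallyI)
  then show ?thesis
    using lim unfolding mult_zero_left by (rule Lim_null_comparison)
qed

subsection \<open>Graphs of rooted trees\<close>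

primrec label :: "rtree \<Rightarrow> nat" where
  "label (Node k M) = k"

text \<open>Tree \<open>Join a b\<close> hangs the root of \<open>b\<close> below the root of \<open>a\<close>; every rooted tree is obtained in
  this way, in general from several terms.\<close>

datatype btree = Vertex nat | Join btree btree

primrec tree_of :: "btree \<Rightarrow> rtree" where
  "tree_of (Vertex k) = Node k {#}"
| "tree_of (Join a b) = Node (label (tree_of a)) (add_mset (tree_of b) (children (tree_of a)))"

primrec wlist :: "btree \<Rightarrow> nat list" where
  "wlist (Vertex k) = [Suc k]"
| "wlist (Join a b) = wlist a @ wlist b"

text \<open>The root is always vertex 0. In a join the vertices of \<open>b\<close> are shifted past
  those of \<open>a\<close>, so the root of \<open>b\<close> becomes vertex
  \<open>length (wlist a)\<close>, and every vertex is numbered after its parent.\<close>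

primrec edge_set :: "btree \<Rightarrow> nat set set" where
  "edge_set (Vertex k) = {}"
| "edge_set (Join a b) =
     edge_set a \<union> (`) (\<lambda>i. i + length (wlist a)) ` edge_set b \<union> {{0, length (wlist a)}}"

definition graph_of :: "btree \<Rightarrow> weighted_graph" where
  "graph_of b = \<lparr>weights = wlist b, edges = edge_set b\<rparr>"

lemma tree_of_surj: "\<exists>b. tree_of b = t"
proof (induction t)
  case (Node k M)
  then show ?case
  proof (induction M)
    case empty
    then show ?case by (intro exI[of _ "Vertex k"]) simp
  next
    case (add s M)
    then obtain a b where "tree_of a = Node k M" "tree_of b = s"
      by fastforce
    then show ?case by (intro exI[of _ "Join a b"]) simp
  qed
qed

lemma length_wlist_pos [simp]: "0 < length (wlist b)"
  by (induction b) auto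

lemma wlist_neq_Nil [simp]: "wlist b \<noteq> []"
  using length_wlist_pos[of b] by (simp del: length_wlist_pos)

lemma wlist_pos: "k \<in> set (wlist b) \<Longrightarrow> 0 < k"
  by (induction b) auto

lemma Node_label_children [simp]: "Node (label t) (children t) = t"
  by (cases t) simp

section \<open>Acyclicity from the numbering of the vertices\<close>

lemma edge_set_simple:
  "e \<in> edge_set b \<Longrightarrow> \<exists>i j. e = {i, j} \<and> i < j \<and> j < length (wlist b)"
proof (induction b arbitrary: e)
  case (Join a b)
  consider "e \<in> edge_set a" | e' where "e' \<in> edge_set b" "e = (\<lambda>i. i + length (wlist a)) ` e'"
    | "e = {0, length (wlist a)}"
    using Join.prems by auto
  then show ?case
  proof cases
    case 1
    then obtain i j where "e = {i, j}" "i < j" "j < length (wlist a)"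
      using Join.IH(1) by blast
    then show ?thesis
      by (intro exI[of _ i] exI[of _ j]) auto
  next
    case 2
    then obtain i j where "e' = {i, j}" "i < j" "j < length (wlist b)"
      using Join.IH(2) by blast
    then show ?thesis using 2
      by (intro exI[of _ "i + length (wlist a)"] exI[of _ "j + length (wlist a)"]) auto
  next
    case 3
    then show ?thesis by (intro exI[of _ 0] exI[of _ "length (wlist a)"]) auto
  qed
qed simp

lemma edge_set_subset: "e \<in> edge_set b \<Longrightarrow> e \<subseteq> {0..<length (wlist b)}"
  using edge_set_simple[of e b] by auto

lemma edge_set_Join_cases:
  assumes "{i, j} \<in> edge_set (Join a b)" "i < j"
  defines "n \<equiv> length (wlist a)"
  shows "j < n \<and> {i, j} \<in> edge_set a \<or> n \<le> i \<and> {i - n, j - n} \<in> edge_set b \<or> i = 0 \<and> j = n"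
proof -
  consider "{i, j} \<in> edge_set a" | e where "e \<in> edge_set b" "{i, j} = (\<lambda>i. i + n) ` e"
    | "{i, j} = {0, n}"
    using assms by auto
  then show ?thesis
  proof cases
    case 1
    then show ?thesis using edge_set_subset[OF 1] by (auto simp: n_def)
  next
    case 2
    then have "e = (\<lambda>k. k - n) ` {i, j}"
      by (simp add: image_image)
    then have "{i - n, j - n} \<in> edge_set b"
      using 2(1) by simp
    moreover have "n \<le> i"
      using 2 by (metis imageE insertI1 le_add2)
    ultimately show ?thesis by blast
  next
    case 3
    then show ?thesis using assms(2) by (auto simp: doubleton_eq_iff)
  qed
qed

text \<open>The smaller neighbour is the parent; all other neighbours of a vertex are its children
  and have larger numbers.\<close>

lemma edge_set_unique_smaller:
  "{i, k} \<in> edge_set b \<Longrightarrow> i < k \<Longrightarrow> {j, k} \<in> edge_set b \<Longrightarrow> j < k \<Longrightarrow> i = j"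
proof (induction b arbitrary: i j k)
  case (Join a b)
  let ?n = "length (wlist a)"
  note c = edge_set_Join_cases[OF Join.prems(1,2)] edge_set_Join_cases[OF Join.prems(3,4)]
  show ?case
  proof (cases "k < ?n")
    case True
    then show ?thesis using c Join by auto
  next
    case False
    show ?thesis
    proof (cases "k = ?n")
      case True
      then show ?thesis using c Join.prems by auto
    next
      case False
      with \<open>\<not> k < ?n\<close> have "?n \<le> i" "?n \<le> j" "{i - ?n, k - ?n} \<in> edge_set b" "{j - ?n, k - ?n} \<in> edge_set b"
        using c by auto
      moreover from this have "i - ?n < k - ?n" "j - ?n < k - ?n"
        using Join.prems by auto
      ultimately have "i - ?n = j - ?n"
        using Join.IH(2) by blast
      then show ?thesis using \<open>?n \<le> i\<close> \<open>?n \<le> j\<close> by simp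
    qed
  qed
qed simp

text \<open>The largest vertex of a cycle would have its successor and its predecessor as smaller
  neighbours, and these are distinct because a cycle has at least three vertices.\<close>

lemma no_cycle_of_unique_smaller:
  assumes simple: "\<And>e. e \<in> edges G \<Longrightarrow> card e = 2"
    and unique: "\<And>i j k. {i, k} \<in> edges G \<Longrightarrow> i < k \<Longrightarrow> {j, k} \<in> edges G \<Longrightarrow> j < k \<Longrightarrow> i = j"
  shows "\<not> is_cycle G c"
proof
  assume c: "is_cycle G c"
  define n where "n = length c"
  have n: "3 \<le> n" "distinct c" and edge: "\<And>i. i < n \<Longrightarrow> {c ! i, c ! (Suc i mod n)} \<in> edges G"
    using c by (auto simp: is_cycle_def n_def)
  have "set c \<noteq> {}"
    using n by (auto simp: n_def)
  then have "Max (set c) \<in> set c"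
    by (intro Max_in) auto
  then obtain i where i: "i < n" "c ! i = Max (set c)"
    by (auto simp: in_set_conv_nth n_def)
  define j where "j = (if i = 0 then n - 1 else i - 1)"
  have j: "j < n" "Suc j mod n = i"
    using i n by (auto simp: j_def)
  have less: "c ! k < c ! i" if "k < n" "{c ! k, c ! i} \<in> edges G" for k
  proof -
    have "c ! k \<noteq> c ! i"
      using simple[OF that(2)] by (auto simp: card_insert_if split: if_splits)
    moreover have "c ! k \<le> c ! i"
      unfolding i(2) using that(1) by (intro Max_ge) (auto simp: n_def)
    ultimately show ?thesis by simp
  qed
  have k: "Suc i mod n < n"
    using n by simp
  have "{c ! (Suc i mod n), c ! i} \<in> edges G" "{c ! j, c ! i} \<in> edges G"
    using edge[OF i(1)] edge[OF j(1)] j(2) by (auto simp: insert_commute)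
  then have "c ! (Suc i mod n) = c ! j"
    using unique less j(1) k by blast
  then have "Suc i mod n = j"
    using n(2) j(1) k by (simp add: nth_eq_iff_index_eq n_def)
  then show False
    using n i by (cases "Suc i = n") (auto simp: j_def split: if_splits)
qed

text \<open>\<open>realizes w V E v t\<close>: the graph with vertices \<open>V\<close> and edges \<open>E\<close>, weighted by \<open>w\<close>, is a tree
  which is isomorphic to \<open>t\<close> when rooted at \<open>v\<close>.\<close>

inductive realizes :: "('v \<Rightarrow> nat) \<Rightarrow> 'v set \<Rightarrow> 'v set set \<Rightarrow> 'v \<Rightarrow> rtree \<Rightarrow> bool" for w where
  single: "w v = Suc k \<Longrightarrow> realizes w {v} {} v (Node k {#})"
| join: "realizes w V E v (Node k M) \<Longrightarrow> realizes w V' E' u s \<Longrightarrow> V \<inter> V' = {} \<Longrightarrow>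
    realizes w (V \<union> V') (E \<union> E' \<union> {{v, u}}) v (Node k (add_mset s M))"

section \<open>Rooted trees and the graphs that realize them\<close>

lemma realizes_finite: "realizes w V E v t \<Longrightarrow> finite V"
  by (induction rule: realizes.induct) auto

lemma realizes_root: "realizes w V E v t \<Longrightarrow> v \<in> V"
  by (induction rule: realizes.induct) auto

lemma realizes_edges: "realizes w V E v t \<Longrightarrow> e \<in> E \<Longrightarrow> e \<subseteq> V"
proof (induction arbitrary: e rule: realizes.induct)
  case (join V E v k M V' E' u s)
  then show ?case
    using realizes_root[OF join(1)] realizes_root[OF join(2)] by blast
qed simp

lemma realizes_wt: "realizes w V E v t \<Longrightarrow> sum w V = wt t"
proof (induction rule: realizes.induct)
  case (join V E v k M V' E' u s)
  then show ?case
    using realizes_finite[OF join(1)] realizes_finite[OF join(2)] by (simp add: sum.union_disjoint)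
qed simp

lemma realizes_root_weight: "realizes w V E v (Node k M) \<Longrightarrow> w v = Suc k"
  by (induction V E v "Node k M" arbitrary: M rule: realizes.induct) auto

lemma realizes_transport:
  assumes "realizes w V E v t" "inj_on f V" "\<And>x. x \<in> V \<Longrightarrow> w' (f x) = w x"
  shows "realizes w' (f ` V) ((`) f ` E) (f v) t"
  using assms
proof (induction rule: realizes.induct)
  case (single v k)
  then show ?case by (auto intro: realizes.single)
next
  case (join V E v k M V' E' u s)
  have "realizes w' (f ` V \<union> f ` V') ((`) f ` E \<union> (`) f ` E' \<union> {{f v, f u}}) (f v) (Node k (add_mset s M))"
  proof (rule realizes.join)
    show "f ` V \<inter> f ` V' = {}"
      using join.hyps(3) join.prems(1) by (auto simp: inj_on_def)
  qed (use join in \<open>auto intro: inj_on_subset\<close>)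
  then show ?case
    by (simp add: image_Un)
qed

lemma graph_of_realizes: "realizes ((!) (wlist b)) {0..<length (wlist b)} (edge_set b) 0 (tree_of b)"
proof (induction b)
  case (Vertex k)
  have "{0..<Suc 0} = {0::nat}"
    by auto
  then show ?case by (auto intro: realizes.single)
next
  case (Join a b)
  let ?n = "length (wlist a)" and ?m = "length (wlist b)"
  let ?w = "(!) (wlist (Join a b))"
  have "realizes ?w (id ` {0..<?n}) ((`) id ` edge_set a) (id 0) (tree_of a)"
    by (rule realizes_transport[OF Join(1)]) (auto simp: nth_append)
  moreover have "realizes ?w ((\<lambda>i. i + ?n) ` {0..<?m}) ((`) (\<lambda>i. i + ?n) ` edge_set b) (0 + ?n) (tree_of b)"
    by (rule realizes_transport[OF Join(2)]) (auto simp: nth_append)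
  ultimately have "realizes ?w ({0..<?n} \<union> (\<lambda>i. i + ?n) ` {0..<?m})
      (edge_set a \<union> (`) (\<lambda>i. i + ?n) ` edge_set b \<union> {{0, ?n}}) 0
      (Node (label (tree_of a)) (add_mset (tree_of b) (children (tree_of a))))"
    by (intro realizes.join) auto
  moreover have "{0..<?n} \<union> (\<lambda>i. i + ?n) ` {0..<?m} = {0..<?n + ?m}"
    by (auto simp: image_iff)  ultimately show ?case by simp
qed

text \<open>A derivation attaches the children in some order, which the multiset forgets.
  Attachments to the same root commute, so any child \<open>s\<close> can be taken as the one
  attached last.\<close>

lemma realizes_add_msetE:
  assumes "realizes w V E v (Node k (add_mset s M))"
  obtains V1 E1 V2 E2 u where "realizes w V1 E1 v (Node k M)" "realizes w V2 E2 u s"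
    "V1 \<inter> V2 = {}" "V = V1 \<union> V2" "E = E1 \<union> E2 \<union> {{v, u}}"
proof -
  have "\<exists>V1 E1 V2 E2 u. realizes w V1 E1 v (Node k M) \<and> realizes w V2 E2 u s \<and>
      V1 \<inter> V2 = {} \<and> V = V1 \<union> V2 \<and> E = E1 \<union> E2 \<union> {{v, u}}"
    using assms
  proof (induction V E v "Node k (add_mset s M)" arbitrary: M rule: realizes.induct)
    case (join V E v M' V' E' u s')
    show ?case
    proof (cases "s = s'")
      case True
      then have "M' = M"
        using join.hyps(6) by simp
      then show ?thesis
        using True join.hyps(1,3,5)
        by (intro exI[of _ V] exI[of _ E] exI[of _ V'] exI[of _ E'] exI[of _ u]) auto
    next
      case False
      then obtain M'' where M'': "M' = add_mset s M''" "M = add_mset s' M''"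
        using join.hyps(6) by (auto simp: add_eq_conv_ex)
      obtain V1 E1 V2 E2 u2 where 1: "realizes w V1 E1 v (Node k M'')" "realizes w V2 E2 u2 s"
        "V1 \<inter> V2 = {}" "V = V1 \<union> V2" "E = E1 \<union> E2 \<union> {{v, u2}}"
        using join.hyps(2)[of M''] M'' by auto
      have "realizes w (V1 \<union> V') (E1 \<union> E' \<union> {{v, u}}) v (Node k M)"
        unfolding M'' using 1 join.hyps by (intro realizes.join) auto
      moreover have "(V1 \<union> V') \<inter> V2 = {}" "V \<union> V' = V1 \<union> V' \<union> V2"
        "E \<union> E' \<union> {{v, u}} = E1 \<union> E' \<union> {{v, u}} \<union> E2 \<union> {{v, u2}}"
        using 1 join.hyps(5) by auto
      ultimately show ?thesis
        using 1(2) by blast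
    qed
  qed simp
  then show thesis using that by blast
qed

text \<open>The term \<open>b\<close> prescribes the order in which branches are detached from the
  realization; the bijections for the two parts are then glued along the numbering of the
  join.\<close>

lemma realizes_tree_of_iso:
  assumes "realizes w V E v (tree_of b)"
  shows "\<exists>f. bij_betw f {0..<length (wlist b)} V \<and> f 0 = v \<and>
    (\<forall>i<length (wlist b). w (f i) = wlist b ! i) \<and> E = (`) f ` edge_set b"
  using assms
proof (induction b arbitrary: V E v)
  case (Vertex k)
  then have "w v = Suc k" "V = {v}" "E = {}"
    by (auto elim: realizes.cases)
  then show ?case
    by (intro exI[of _ "\<lambda>_. v"]) (auto simp: bij_betw_def)
next
  case (Join a b)
  let ?n = "length (wlist a)" and ?m = "length (wlist b)"
  obtain V1 E1 V2 E2 u where 1: "realizes w V1 E1 v (tree_of a)" "realizes w V2 E2 u (tree_of b)"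
    and disj: "V1 \<inter> V2 = {}" and V: "V = V1 \<union> V2" and E: "E = E1 \<union> E2 \<union> {{v, u}}"
    using realizes_add_msetE[OF Join.prems[unfolded tree_of.simps]] by (metis Node_label_children)
  obtain f where f: "bij_betw f {0..<?n} V1" "f 0 = v" "\<And>i. i < ?n \<Longrightarrow> w (f i) = wlist a ! i"
    "E1 = (`) f ` edge_set a"
    using Join.IH(1)[OF 1(1)] by blast
  obtain g where g: "bij_betw g {0..<?m} V2" "g 0 = u" "\<And>i. i < ?m \<Longrightarrow> w (g i) = wlist b ! i"
    "E2 = (`) g ` edge_set b"
    using Join.IH(2)[OF 1(2)] by blast
  define h where "h i = (if i < ?n then f i else g (i - ?n))" for i
  have "bij_betw h {0..<?n} V1"
    using f(1) by (subst bij_betw_cong[of _ _ f]) (auto simp: h_def)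
  moreover have "bij_betw (\<lambda>i. i - ?n) {?n..<?n + ?m} {0..<?m}"
    by (rule bij_betw_byWitness[of _ "\<lambda>i. i + ?n"]) auto
  then have "bij_betw (g \<circ> (\<lambda>i. i - ?n)) {?n..<?n + ?m} V2"
    using g(1) by (rule bij_betw_trans)
  then have "bij_betw h {?n..<?n + ?m} V2"
    by (subst bij_betw_cong[of _ _ "g \<circ> (\<lambda>i. i - ?n)"]) (auto simp: h_def)
  ultimately have "bij_betw h ({0..<?n} \<union> {?n..<?n + ?m}) V"
    unfolding V using disj by (rule bij_betw_combine)
  then have "bij_betw h {0..<length (wlist (Join a b))} V"
    by (simp add: ivl_disj_un)
  moreover have "w (h i) = wlist (Join a b) ! i" if "i < length (wlist (Join a b))" for i
    using that f(3)[of i] g(3)[of "i - ?n"] by (auto simp: h_def nth_append)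
  moreover have "E = (`) h ` edge_set (Join a b)"
  proof -
    have "(`) h ` edge_set a = E1"
      unfolding f(4) using edge_set_subset[of _ a] by (intro image_cong refl) (fastforce simp: h_def)
    moreover have "(`) h ` (`) (\<lambda>i. i + ?n) ` edge_set b = E2"
    proof -
      have "h (i + ?n) = g i" for i
        by (simp add: h_def)
      then have "h ` (\<lambda>i. i + ?n) ` e = g ` e" for e
        by (simp add: image_image)
      then show ?thesis
        unfolding g(4) by (simp only: image_image[of "(`) h" "(`) (\<lambda>i. i + ?n)"])
    qed
    moreover have "h ` {0, ?n} = {v, u}"
      using f(2) g(2) by (auto simp: h_def)
    ultimately show ?thesis
      unfolding E by (simp add: image_Un)
  qed
  moreover have "h 0 = v"
    using f(2) by (simp add: h_def)
  ultimately show ?case by blast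
qed

text \<open>Taking \<open>p = v\<close> excludes no neighbour, as the graphs have no loops.\<close>

primrec unfold_tree :: "('v \<Rightarrow> nat) \<Rightarrow> 'v set set \<Rightarrow> nat \<Rightarrow> 'v \<Rightarrow> 'v \<Rightarrow> rtree" where
  "unfold_tree w E 0 v p = Node 0 {#}"
| "unfold_tree w E (Suc d) v p =
     Node (w v - 1) (image_mset (\<lambda>u. unfold_tree w E d u v) (mset_set ({u. {v, u} \<in> E} - {p})))"

lemma realizes_no_loop: "realizes w V E v t \<Longrightarrow> {x} \<notin> E"
proof (induction rule: realizes.induct)
  case (join V E v k M V' E' u s)
  then show ?case
    using realizes_root[OF join(1)] realizes_root[OF join(2)] by (auto simp: doubleton_eq_iff)
qed simp

text \<open>The larger edge set \<open>E'\<close>, in which only the root \<open>v\<close> may have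
  further edges, makes the induction work for both parts of a join: \<open>v\<close> gains the edge
  to \<open>u\<close>, and \<open>u\<close> gains the edge back to \<open>v\<close>, which the
  unfolding skips because it arrives from there.\<close>

lemma realizes_children:
  assumes "realizes w V E v t"
    and "E \<subseteq> E'" "\<And>x e. x \<in> V - {v} \<Longrightarrow> e \<in> E' \<Longrightarrow> x \<in> e \<Longrightarrow> e \<in> E" "card V \<le> Suc d"
  shows "children t = image_mset (\<lambda>u. unfold_tree w E' d u v) (mset_set {u. {v, u} \<in> E})"
  using assms
proof (induction arbitrary: d rule: realizes.induct)
  case (join V E v k M V2 E2 u s)
  note fin = realizes_finite[OF join.hyps(1)] realizes_finite[OF join.hyps(2)]
  note root = realizes_root[OF join.hyps(1)] realizes_root[OF join.hyps(2)]
  note sub = realizes_edges[OF join.hyps(1)] realizes_edges[OF join.hyps(2)]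
  have card: "card (V \<union> V2) = card V + card V2" "card V \<ge> 1" "card V2 \<ge> 1"
    using fin root join.hyps(3) by (auto simp: card_Un_disjoint Suc_le_eq card_gt_0_iff)
  have "e \<in> E" if "x \<in> V - {v}" "e \<in> E'" "x \<in> e" for x e
    using join.prems(2)[of x e] that sub(2)[of e] root join.hyps(3) by auto
  then have M: "M = image_mset (\<lambda>u. unfold_tree w E' d u v) (mset_set {u. {v, u} \<in> E})"
    using join.IH(1)[of d] join.prems(1,3) card by auto
  obtain d' where d': "d = Suc d'"
    using card join.prems(3) by (cases d) auto
  have E2: "e \<in> E2" if "x \<in> V2 - {u}" "e \<in> E'" "x \<in> e" for x e
    using join.prems(2)[of x e] that sub(1)[of e] root join.hyps(3) by auto
  have nbrs: "{z. {u, z} \<in> E'} - {v} = {z. {u, z} \<in> E2}"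
  proof (intro equalityI subsetI)
    fix z assume z: "z \<in> {z. {u, z} \<in> E'} - {v}"
    then have "{u, z} \<in> E \<union> E2 \<union> {{v, u}}"
      using join.prems(2)[of u "{u, z}"] root join.hyps(3) by auto
    then show "z \<in> {z. {u, z} \<in> E2}"
      using z sub(1)[of "{u, z}"] root join.hyps(3) by (auto simp: doubleton_eq_iff)
  next
    fix z assume "z \<in> {z. {u, z} \<in> E2}"
    then show "z \<in> {z. {u, z} \<in> E'} - {v}"
      using join.prems(1) sub(2)[of "{u, z}"] root join.hyps(3) by auto
  qed
  have "children s = image_mset (\<lambda>z. unfold_tree w E' d' z u) (mset_set {z. {u, z} \<in> E2})"
    using join.IH(2)[of d'] E2 join.prems(1,3) card d' by auto
  moreover have "w u - 1 = label s"
    using realizes_root_weight[of w V2 E2 u "label s" "children s"] join.hyps(2) by simp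
  ultimately have s: "s = unfold_tree w E' d u v"
    using Node_label_children[of s] by (simp add: d' nbrs)
  have "{z. {v, z} \<in> E \<union> E2 \<union> {{v, u}}} = insert u {z. {v, z} \<in> E}"
    using sub(2) root join.hyps(3) by (auto simp: doubleton_eq_iff)
  moreover have "u \<notin> {z. {v, z} \<in> E}" "finite {z. {v, z} \<in> E}"
    using sub(1) root join.hyps(3) fin(1) by (auto intro: finite_subset[of _ V])
  ultimately show ?case
    using M s by simp
qed simp

text \<open>Exhibits the rooted tree as a function of the graph and the root, so that a graph gives
  rise to at most one rooted tree per vertex.\<close>

lemma realizes_unfold_tree:
  assumes "realizes w V E v t"
  shows "t = unfold_tree w E (Suc (card V)) v v"
proof -
  have "children t = image_mset (\<lambda>u. unfold_tree w E (card V) u v) (mset_set {u. {v, u} \<in> E})"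
    by (rule realizes_children[OF assms]) auto
  moreover have "{u. {v, u} \<in> E} - {v} = {u. {v, u} \<in> E}"
    using realizes_no_loop[OF assms, of v] by auto
  moreover have "w v - 1 = label t"
    using realizes_root_weight[of w V E v "label t" "children t"] assms by simp
  ultimately show ?thesis
    using Node_label_children[of t] by simp
qed

text \<open>Besides connectivity the path serves to produce a cycle, hence its distinct vertices.
  Paths in the two parts of a join are concatenated across the edge between the roots.\<close>

lemma realizes_path:
  assumes "realizes w V E v t" "x \<in> V" "y \<in> V"
  shows "\<exists>p. p \<noteq> [] \<and> hd p = x \<and> last p = y \<and> distinct p \<and> set p \<subseteq> V \<and>
    successively (\<lambda>a b. {a, b} \<in> E) p"
  using assms
proof (induction arbitrary: x y rule: realizes.induct)
  case (single v k)
  then show ?case by (intro exI[of _ "[v]"]) auto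
next
  case (join V E v k M V2 E2 u s)
  let ?R = "\<lambda>a b. {a, b} \<in> E \<union> E2 \<union> {{v, u}}"
  note root = realizes_root[OF join.hyps(1)] realizes_root[OF join.hyps(2)]
  have mono: "successively ?R p" if "successively (\<lambda>a b. {a, b} \<in> F) p" "F \<subseteq> E \<union> E2" for p F
    using that by (auto elim: successively_mono)
  have cross: "\<exists>p. p \<noteq> [] \<and> hd p = x \<and> last p = y \<and> distinct p \<and> set p \<subseteq> V \<union> V2 \<and> successively ?R p"
    if xy: "x \<in> V" "y \<in> V2" for x y
  proof -
    obtain p where p: "p \<noteq> []" "hd p = x" "last p = v" "distinct p" "set p \<subseteq> V"
      "successively (\<lambda>a b. {a, b} \<in> E) p"
      using join.IH(1)[OF xy(1) root(1)] by blast
    obtain q where q: "q \<noteq> []" "hd q = u" "last q = y" "distinct q" "set q \<subseteq> V2"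
      "successively (\<lambda>a b. {a, b} \<in> E2) q"
      using join.IH(2)[OF root(2) xy(2)] by blast
    have "successively ?R (p @ q)"
      using mono[OF p(6)] mono[OF q(6)] p q by (auto simp: successively_append_iff)
    then show ?thesis
      using p q join.hyps(3) by (intro exI[of _ "p @ q"]) auto
  qed
  consider "x \<in> V" "y \<in> V" | "x \<in> V2" "y \<in> V2" | "x \<in> V" "y \<in> V2" | "x \<in> V2" "y \<in> V"
    using join.prems by blast
  then show ?case
  proof cases
    case 1
    then obtain p where p: "p \<noteq> []" "hd p = x" "last p = y" "distinct p" "set p \<subseteq> V"
      "successively (\<lambda>a b. {a, b} \<in> E) p"
      using join.IH(1) by blast
    then show ?thesis using mono[OF p(6)] by (intro exI[of _ p]) auto
  next
    case 2
    then obtain p where p: "p \<noteq> []" "hd p = x" "last p = y" "distinct p" "set p \<subseteq> V2"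
      "successively (\<lambda>a b. {a, b} \<in> E2) p"
      using join.IH(2) by blast
    then show ?thesis using mono[OF p(6)] by (intro exI[of _ p]) auto
  next
    case 3
    then show ?thesis by (rule cross)
  next
    case 4
    then obtain p where p: "p \<noteq> []" "hd p = y" "last p = x" "distinct p" "set p \<subseteq> V \<union> V2" "successively ?R p"
      using cross by blast
    then show ?thesis
      by (intro exI[of _ "rev p"]) (auto simp: hd_rev last_rev insert_commute)
  qed
qed

lemma realizes_insert_leaf:
  assumes "realizes w V E v t" "x \<in> V" "y \<notin> V" "0 < w y"
  shows "\<exists>t'. realizes w (insert y V) (insert {x, y} E) v t'"
  using assms
proof (induction arbitrary: x rule: realizes.induct)
  case (single v k)
  have "realizes w {y} {} y (Node (w y - 1) {#})"
    using single by (intro realizes.single) simp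
  then have "realizes w ({v} \<union> {y}) ({} \<union> {} \<union> {{v, y}}) v (Node k (add_mset (Node (w y - 1) {#}) {#}))"
    using single by (intro realizes.join realizes.single) auto
  then show ?case
    using single by (auto simp: insert_commute)
next
  case (join V E v k M V2 E2 u s)
  show ?case
  proof (cases "x \<in> V")
    case True
    then obtain t' where t': "realizes w (insert y V) (insert {x, y} E) v t'"
      using join by blast
    then have "realizes w (insert y V \<union> V2) (insert {x, y} E \<union> E2 \<union> {{v, u}}) v
        (Node (label t') (add_mset s (children t')))"
      using join by (intro realizes.join) auto
    then show ?thesis by (auto simp: insert_commute)
  next
    case False
    then obtain t' where t': "realizes w (insert y V2) (insert {x, y} E2) u t'"
      using join by blast
    then have "realizes w (V \<union> insert y V2) (E \<union> insert {x, y} E2 \<union> {{v, u}}) v (Node k (add_mset t' M))"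
      using join by (intro realizes.join) auto
    then show ?thesis by (auto simp: insert_commute)
  qed
qed

lemma rtrancl_of_successively:
  "p \<noteq> [] \<Longrightarrow> successively (\<lambda>a b. {a, b} \<in> E) p \<Longrightarrow> (hd p, last p) \<in> {(x, y). {x, y} \<in> E}\<^sup>*"
proof (induction p)
  case (Cons a p)
  show ?case
  proof (cases "p = []")
    case False
    then have "(a, hd p) \<in> {(x, y). {x, y} \<in> E}" "(hd p, last p) \<in> {(x, y). {x, y} \<in> E}\<^sup>*"
      using Cons by (auto simp: successively_Cons)
    then show ?thesis
      using False by (auto intro: converse_rtrancl_into_rtrancl)
  qed simp
qed simp

section \<open>Passage between terms and weighted trees\<close>

lemma graph_of_simps [simp]:
  "weights (graph_of b) = wlist b"
  "edges (graph_of b) = edge_set b"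
  "verts (graph_of b) = {0..<length (wlist b)}"
  by (simp_all add: verts_def num_verts_def graph_of_def)

lemma total_weight_graph_of: "total_weight (graph_of b) = wt (tree_of b)"
  using realizes_wt[OF graph_of_realizes[of b]] by (simp add: total_weight_def)

lemma weighted_tree_graph_of: "weighted_tree (graph_of b)"
proof -
  have card2: "card e = 2" if "e \<in> edge_set b" for e
    using edge_set_simple[OF that] by auto
  have "simple_graph (graph_of b)"
    using edge_set_subset card2 by (simp add: simple_graph_def)
  moreover have "connected_graph (graph_of b)"
    unfolding connected_graph_def
  proof (intro conjI ballI)
    fix x y assume "x \<in> verts (graph_of b)" "y \<in> verts (graph_of b)"
    then obtain p where "p \<noteq> []" "hd p = x" "last p = y" "successively (\<lambda>a b'. {a, b'} \<in> edge_set b) p"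
      using realizes_path[OF graph_of_realizes[of b], of x y] by auto
    then show "(x, y) \<in> {(x, y). {x, y} \<in> edges (graph_of b)}\<^sup>*"
      using rtrancl_of_successively[of p "edge_set b"] by simp
  qed simp
  moreover have "\<not> is_cycle (graph_of b) c" for c
  proof (rule no_cycle_of_unique_smaller)
    show "card e = 2" if "e \<in> edges (graph_of b)" for e
      using that card2 by simp
    show "i = j" if "{i, k} \<in> edges (graph_of b)" "i < k" "{j, k} \<in> edges (graph_of b)" "j < k" for i j k
      using edge_set_unique_smaller[of i k b j] that by simp
  qed
  moreover have "0 < weights (graph_of b) ! v" if "v \<in> verts (graph_of b)" for v
    using that wlist_pos[of "wlist b ! v" b] by simp
  ultimately show ?thesis
    unfolding weighted_tree_def by blast
qed

lemma rtrancl_leaves_set: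
  "(v, z) \<in> R\<^sup>* \<Longrightarrow> v \<in> V \<Longrightarrow> z \<notin> V \<Longrightarrow> \<exists>x y. (x, y) \<in> R \<and> x \<in> V \<and> y \<notin> V"
  by (induction rule: rtrancl_induct) blast+

lemma cycle_of_path:
  assumes p: "distinct p" "successively (\<lambda>a b. {a, b} \<in> E) p" "2 \<le> length p" "y \<notin> set p"
    and e: "{y, hd p} \<in> E" "{last p, y} \<in> E" and E: "E \<subseteq> edges G"
  shows "is_cycle G (p @ [y])"
  unfolding is_cycle_def
proof (intro conjI allI impI)
  fix i assume "i < length (p @ [y])"
  then consider "Suc i < length p" | "Suc i = length p" | "i = length p"
    by fastforce
  then show "{(p @ [y]) ! i, (p @ [y]) ! (Suc i mod length (p @ [y]))} \<in> edges G"
  proof cases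
    case 1
    then show ?thesis
      using p(2) E by (auto simp: nth_append successively_conv_nth)
  next
    case 2
    then have "i = length p - 1" "p \<noteq> []"
      by auto
    then show ?thesis
      using 2 e(2) E by (auto simp: nth_append last_conv_nth)
  next
    case 3
    then show ?thesis
      using e(1) E p(3) by (auto simp: nth_append hd_conv_nth)
  qed
qed (use p in auto)

text \<open>A subtree is grown from \<open>v\<close> one vertex at a time. Connectedness provides an
  edge from \<open>V\<close> to a new vertex \<open>y\<close>; absence of cycles makes it the only
  one, so the induced edge set gains exactly this edge and \<open>y\<close> is attached as a
  leaf.\<close>

lemma weighted_tree_partial_realizes:
  assumes G: "weighted_tree G" and v: "v \<in> verts G" and n: "1 \<le> n" "n \<le> card (verts G)"
  shows "\<exists>V t. V \<subseteq> verts G \<and> card V = n \<and> realizes ((!) (weights G)) V {e \<in> edges G. e \<subseteq> V} v t"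
  using n
proof (induction n rule: dec_induct)
  case base
  have "{e \<in> edges G. e \<subseteq> {v}} = {}"
    using G by (auto simp: weighted_tree_def simple_graph_def subset_singleton_iff)
  moreover have "weights G ! v = Suc (weights G ! v - 1)"
    using G v by (simp add: weighted_tree_def)
  ultimately have "realizes ((!) (weights G)) {v} {e \<in> edges G. e \<subseteq> {v}} v (Node (weights G ! v - 1) {#})"
    by (simp only: realizes.single)
  then show ?case
    using v by (intro exI[of _ "{v}"]) auto
next
  case (step n)
  then obtain V t where V: "V \<subseteq> verts G" "card V = n"
    and t: "realizes ((!) (weights G)) V {e \<in> edges G. e \<subseteq> V} v t" (is "realizes _ _ ?E _ _")
    by auto
  have "V \<noteq> verts G"
    using V step by auto
  then obtain z where "z \<in> verts G" "z \<notin> V"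
    using V by auto
  moreover have "v \<in> V"
    using t by (rule realizes_root)
  ultimately obtain x y where xy: "{x, y} \<in> edges G" "x \<in> V" "y \<notin> V"
    using G v rtrancl_leaves_set[of v z "{(x, y). {x, y} \<in> edges G}" V]
    by (auto simp: weighted_tree_def connected_graph_def)
  have y: "y \<in> verts G"
    using G xy by (auto simp: weighted_tree_def simple_graph_def)
  have "{e \<in> edges G. e \<subseteq> insert y V} = insert {x, y} ?E"
  proof (intro equalityI subsetI)
    fix e assume e: "e \<in> {e \<in> edges G. e \<subseteq> insert y V}"
    show "e \<in> insert {x, y} ?E"
    proof (cases "y \<in> e")
      case True
      have "card e = 2"
        using e G by (auto simp: weighted_tree_def simple_graph_def)
      then obtain x' where x': "e = {x', y}" "x' \<noteq> y"
        using True by (auto simp: card_2_iff)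
      then have "x' \<in> V"
        using e by auto
      \<comment> \<open>Two different neighbours of \<open>y\<close> in \<open>V\<close> are joined
        by a path inside \<open>V\<close>, which closes up through \<open>y\<close> to a
        cycle.\<close>
      have "x' = x"
      proof (rule ccontr)
        assume "x' \<noteq> x"
        obtain p where p: "p \<noteq> []" "hd p = x" "last p = x'" "distinct p" "set p \<subseteq> V"
          "successively (\<lambda>a b. {a, b} \<in> ?E) p"
          using realizes_path[OF t xy(2) \<open>x' \<in> V\<close>] by blast
        have "2 \<le> length p"
          using p \<open>x' \<noteq> x\<close> by (cases p; cases "tl p") auto
        moreover have "successively (\<lambda>a b. {a, b} \<in> edges G) p"
          using p(6) by (rule successively_mono) auto
        ultimately have "is_cycle G (p @ [y])"
          using p x' xy e by (intro cycle_of_path[where E = "edges G"]) (auto simp: insert_commute)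
        then show False
          using G by (simp add: weighted_tree_def)
      qed
      then show ?thesis
        using x' by simp
    qed (use e in auto)
  qed (use xy in auto)
  moreover have "0 < weights G ! y"
    using G y by (simp add: weighted_tree_def)
  ultimately obtain t' where "realizes ((!) (weights G)) (insert y V) {e \<in> edges G. e \<subseteq> insert y V} v t'"
    using realizes_insert_leaf[OF t xy(2,3)] by auto
  moreover have "card (insert y V) = Suc n"
    using V xy realizes_finite[OF t] by simp
  ultimately show ?case
    using V y by (intro exI[of _ "insert y V"]) auto
qed

lemma finite_verts [simp]: "finite (verts G)"
  by (simp add: verts_def)

lemma weighted_tree_realizes:
  assumes G: "weighted_tree G" and v: "v \<in> verts G"
  shows "\<exists>t. realizes ((!) (weights G)) (verts G) (edges G) v t"
proof -
  have "1 \<le> card (verts G)"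
    using v by (auto simp: Suc_le_eq card_gt_0_iff)
  then obtain V t where V: "V \<subseteq> verts G" "card V = card (verts G)"
    and t: "realizes ((!) (weights G)) V {e \<in> edges G. e \<subseteq> V} v t"
    using weighted_tree_partial_realizes[OF G v] by blast
  have "V = verts G"
    using V by (intro card_subset_eq) auto
  moreover have "{e \<in> edges G. e \<subseteq> verts G} = edges G"
    using G by (auto simp: weighted_tree_def simple_graph_def)
  ultimately show ?thesis
    using t by auto
qed

lemma total_weight_realizes:
  assumes "realizes ((!) (weights G)) (verts G) (edges G) v t"
  shows "total_weight G = wt t"
  using realizes_wt[OF assms] by (simp add: total_weight_def)

lemma weighted_iso_graph_of:
  assumes "realizes ((!) (weights G)) (verts G) (edges G) v (tree_of b)"
  shows "weighted_iso (graph_of b) G"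
proof -
  obtain f where f: "bij_betw f {0..<length (wlist b)} (verts G)"
    "\<And>i. i < length (wlist b) \<Longrightarrow> weights G ! f i = wlist b ! i" "edges G = (`) f ` edge_set b"
    using realizes_tree_of_iso[OF assms] by blast
  have "{i, j} \<in> edge_set b \<longleftrightarrow> {f i, f j} \<in> edges G"
    if ij: "i \<in> {0..<length (wlist b)}" "j \<in> {0..<length (wlist b)}" for i j
  proof
    assume "{i, j} \<in> edge_set b"
    then have "f ` {i, j} \<in> edges G"
      unfolding f(3) by blast
    then show "{f i, f j} \<in> edges G"
      by simp
  next
    assume "{f i, f j} \<in> edges G"
    then obtain e where e: "e \<in> edge_set b" "f ` {i, j} = f ` e"
      unfolding f(3) by auto
    have "{i, j} \<subseteq> {0..<length (wlist b)}"
      using ij by simp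
    then have "{i, j} = e"
      using e inj_on_image_eq_iff[OF bij_betw_imp_inj_on[OF f(1)] _ edge_set_subset[OF e(1)]] by blast
    then show "{i, j} \<in> edge_set b"
      using e by simp
  qed
  then show ?thesis
    unfolding weighted_iso_def using f(1,2) by (intro exI[of _ f]) simp
qed

lemma realizes_edge_pair: "realizes w V E v t \<Longrightarrow> e \<in> E \<Longrightarrow> \<exists>a b. e = {a, b}"
  by (induction rule: realizes.induct) auto

text \<open>Used to find a given rooted tree again in the chosen representative of its isomorphism
  class.\<close>

lemma realizes_weighted_iso:
  assumes "weighted_iso G H" and "realizes ((!) (weights G)) (verts G) (edges G) v t"
    and "weighted_tree H"
  shows "\<exists>v'\<in>verts H. realizes ((!) (weights H)) (verts H) (edges H) v' t"
proof -
  obtain f where f: "bij_betw f (verts G) (verts H)"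
    and e: "\<And>u v. u \<in> verts G \<Longrightarrow> v \<in> verts G \<Longrightarrow> {u, v} \<in> edges G \<longleftrightarrow> {f u, f v} \<in> edges H"
    and w: "\<And>v. v \<in> verts G \<Longrightarrow> weights H ! f v = weights G ! v"
    using assms(1) unfolding weighted_iso_def by blast
  have "edges H = (`) f ` edges G"
  proof (intro equalityI subsetI)
    fix d assume d: "d \<in> edges H"
    then have "card d = 2" "d \<subseteq> verts H"
      using assms(3) by (auto simp: weighted_tree_def simple_graph_def)
    then obtain a b where "d = {a, b}" "a \<in> verts H" "b \<in> verts H"
      by (auto simp: card_2_iff)
    moreover from this obtain a' b' where "a = f a'" "b = f b'" "a' \<in> verts G" "b' \<in> verts G"
      using bij_betw_imp_surj_on[OF f] by blast
    ultimately show "d \<in> (`) f ` edges G"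
      using e d by (intro image_eqI[of _ _ "{a', b'}"]) auto
  next
    fix d assume "d \<in> (`) f ` edges G"
    then obtain d' where d': "d' \<in> edges G" "d = f ` d'"
      by auto
    then obtain a b where "d' = {a, b}" "a \<in> verts G" "b \<in> verts G"
      using realizes_edges[OF assms(2) d'(1)] realizes_edge_pair[OF assms(2) d'(1)] by auto
    then show "d \<in> edges H"
      using d' e by auto
  qed
  then have r: "realizes ((!) (weights H)) (verts H) (edges H) (f v) t"
    using realizes_transport[OF assms(2), of f "(!) (weights H)"] f w by (simp add: bij_betw_def)
  show ?thesis
    using r realizes_root[OF r] by (rule bexI)
qed

subsection \<open>Characteristic polynomials of joined trees\<close>

text \<open>The edge between the two roots, seen as an off-diagonal block of the adjacency matrix of
  a join: both roots have index 0 in their own part.\<close>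

definition corner_mat :: "nat \<Rightarrow> nat \<Rightarrow> 'a :: comm_ring_1 mat" where
  "corner_mat n m = mat n m (\<lambda>(i, j). if i = 0 \<and> j = 0 then 1 else 0)"

lemma corner_mat_carrier [simp]: "corner_mat n m \<in> carrier_mat n m"
  by (simp add: corner_mat_def)

lemma corner_mat_dim [simp]: "dim_row (corner_mat n m) = n" "dim_col (corner_mat n m) = m"
  by (simp_all add: corner_mat_def)

lemma mult_corner_mat_index:
  assumes "A \<in> carrier_mat k n" "0 < n" "i < k" "j < m"
  shows "(A * corner_mat n m) $$ (i, j) = (if j = 0 then A $$ (i, 0) else 0)"
proof -
  have "(A * corner_mat n m) $$ (i, j) = (\<Sum>l = 0..<n. A $$ (i, l) * (if l = 0 \<and> j = 0 then 1 else 0))"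
    using assms by (simp add: scalar_prod_def corner_mat_def)
  also have "\<dots> = (\<Sum>l = 0..<n. if l = 0 then (if j = 0 then A $$ (i, 0) else 0) else 0)"
    by (intro sum.cong) auto
  also have "\<dots> = (if j = 0 then A $$ (i, 0) else 0)"
    using assms(2) by (subst sum.delta) auto
  finally show ?thesis .
qed

lemma corner_mat_mult_index:
  assumes "A \<in> carrier_mat n k" "0 < n" "i < m" "j < k"
  shows "(corner_mat m n * A) $$ (i, j) = (if i = 0 then A $$ (0, j) else 0)"
proof -
  have "(corner_mat m n * A) $$ (i, j) = (\<Sum>l = 0..<n. (if i = 0 \<and> l = 0 then 1 else 0) * A $$ (l, j))"
    using assms by (simp add: scalar_prod_def corner_mat_def)
  also have "\<dots> = (\<Sum>l = 0..<n. if l = 0 then (if i = 0 then A $$ (0, j) else 0) else 0)"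
    by (intro sum.cong) auto
  also have "\<dots> = (if i = 0 then A $$ (0, j) else 0)"
    using assms(2) by (subst sum.delta) auto
  finally show ?thesis .
qed

lemma cofactor_0_0: "cofactor A 0 0 = det (mat_delete A 0 0)"
  by (simp add: cofactor_def)

text \<open>Only the entry at (0, 0) is affected by the subtraction, and no cofactor along row 0
  contains it. These cofactors are those of \<open>B\<close> multiplied by
  \<open>p ^ (m - 1)\<close>, and the expansion is linear in row 0.\<close>

lemma det_smult_sub_corner:
  fixes B :: "'a :: comm_ring_1 mat"
  assumes B: "B \<in> carrier_mat m m" and m: "0 < m"
  shows "det (p \<cdot>\<^sub>m B - q \<cdot>\<^sub>m corner_mat m m) = p ^ (m - 1) * (p * det B - q * det (mat_delete B 0 0))"
proof -
  define X where "X = p \<cdot>\<^sub>m B - q \<cdot>\<^sub>m corner_mat m m"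
  have X: "X \<in> carrier_mat m m"
    by (rule carrier_matI) (simp_all add: X_def)
  have "mat_delete X 0 j = p \<cdot>\<^sub>m mat_delete B 0 j" if "j < m" for j
    by (rule eq_matI) (use B that in \<open>auto simp: X_def mat_delete_def corner_mat_def\<close>)
  then have cof: "cofactor X 0 j = p ^ (m - 1) * cofactor B 0 j" if "j < m" for j
    using that B by (simp add: cofactor_def)
  have "det X = (\<Sum>j<m. X $$ (0, j) * cofactor X 0 j)"
    by (rule laplace_expansion_row[OF X m])
  also have "\<dots> = (\<Sum>j<m. p ^ (m - 1) * (p * (B $$ (0, j) * cofactor B 0 j))
      - (if j = 0 then p ^ (m - 1) * (q * cofactor B 0 0) else 0))"
  proof (rule sum.cong)
    fix j assume "j \<in> {..<m}"
    then have X0: "X $$ (0, j) = p * B $$ (0, j) - (if j = 0 then q else 0)"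
      using B m by (simp add: X_def corner_mat_def)
    then show "X $$ (0, j) * cofactor X 0 j = p ^ (m - 1) * (p * (B $$ (0, j) * cofactor B 0 j))
      - (if j = 0 then p ^ (m - 1) * (q * cofactor B 0 0) else 0)"
      using \<open>j \<in> {..<m}\<close> by (simp add: X0 cof algebra_simps)
  qed simp
  also have "\<dots> = p ^ (m - 1) * (p * (\<Sum>j<m. B $$ (0, j) * cofactor B 0 j)) - p ^ (m - 1) * (q * cofactor B 0 0)"
    using m by (simp add: sum_subtractf sum_distrib_left sum.delta)
  also have "(\<Sum>j<m. B $$ (0, j) * cofactor B 0 j) = det B"
    by (rule laplace_expansion_row[OF B m, symmetric])
  finally show ?thesis
    by (simp add: X_def cofactor_0_0 algebra_simps)
qed

text \<open>Multiplying by a block matrix built from the adjugate of \<open>A\<close> clears the upper right block.\<close>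

lemma det_joined_blocks:
  fixes A B :: "'a :: idom mat"
  assumes A: "A \<in> carrier_mat n n" and B: "B \<in> carrier_mat m m"
    and n: "0 < n" and m: "0 < m" and nz: "det A \<noteq> 0"
  shows "det (four_block_mat A (- corner_mat n m) (- corner_mat m n) B)
    = det A * det B - det (mat_delete A 0 0) * det (mat_delete B 0 0)"
proof -
  define p q where "p = det A" and "q = det (mat_delete A 0 0)"
  define U :: "'a mat" where "U = corner_mat n m"
  define V :: "'a mat" where "V = corner_mat m n"
  define W where "W = adj_mat A * U"
  have [simp]: "U \<in> carrier_mat n m" "V \<in> carrier_mat m n" "adj_mat A \<in> carrier_mat n n"
    using adj_mat(1)[OF A] by (simp_all add: U_def V_def)
  have [simp]: "dim_row U = n" "dim_col U = m" "dim_row V = m" "dim_col V = n"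
    by (simp_all add: U_def V_def)
  have W: "W \<in> carrier_mat n m"
    by (simp add: W_def mult_carrier_mat[of _ n n])
  let ?G = "four_block_mat (1\<^sub>m n) W (0\<^sub>m m n) (p \<cdot>\<^sub>m 1\<^sub>m m)"
  let ?M = "four_block_mat A (- U) (- V) B"
  have "A * W = p \<cdot>\<^sub>m U"
  proof -
    have "A * W = (A * adj_mat A) * U"
      unfolding W_def using assoc_mult_mat[OF A, of "adj_mat A" n U m] by simp
    also have "\<dots> = p \<cdot>\<^sub>m (1\<^sub>m n * U)"
      unfolding adj_mat(2)[OF A] p_def by (rule mult_smult_assoc_mat[of _ n n _ m]) auto
    also have "1\<^sub>m n * U = U"
      by (rule left_mult_one_mat[of _ n m]) simp
    finally show ?thesis .
  qed
  moreover have "- U * (p \<cdot>\<^sub>m 1\<^sub>m m) = - (p \<cdot>\<^sub>m U)"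
  proof -
    have "- U * (p \<cdot>\<^sub>m 1\<^sub>m m) = p \<cdot>\<^sub>m (- U * 1\<^sub>m m)"
      by (rule mult_smult_distrib[of _ n m]) auto
    also have "- U * 1\<^sub>m m = - U"
      by (rule right_mult_one_mat[of _ n m]) simp
    also have "p \<cdot>\<^sub>m (- U) = - (p \<cdot>\<^sub>m U)"
      by (rule eq_matI) auto
    finally show ?thesis .
  qed
  moreover have "p \<cdot>\<^sub>m U + - (p \<cdot>\<^sub>m U) = 0\<^sub>m n m"
    by (rule eq_matI) auto
  ultimately have upper: "A * W + - U * (p \<cdot>\<^sub>m 1\<^sub>m m) = 0\<^sub>m n m"
    by simp
  have VW: "V * W = q \<cdot>\<^sub>m corner_mat m m"
  proof (rule eq_matI)
    fix i j assume "i < dim_row (q \<cdot>\<^sub>m corner_mat m m)" "j < dim_col (q \<cdot>\<^sub>m corner_mat m m)"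
    then have ij: "i < m" "j < m" by auto
    have "(V * W) $$ (i, j) = (if i = 0 then W $$ (0, j) else 0)"
      unfolding V_def by (rule corner_mat_mult_index[OF W n ij])
    also have "W $$ (0, j) = (if j = 0 then adj_mat A $$ (0, 0) else 0)"
      unfolding W_def U_def by (rule mult_corner_mat_index[OF _ n n ij(2)]) simp
    also have "adj_mat A $$ (0, 0) = q"
      using A n by (simp add: adj_mat_def cofactor_0_0 q_def)
    finally show "(V * W) $$ (i, j) = (q \<cdot>\<^sub>m corner_mat m m) $$ (i, j)"
      using ij by (simp add: corner_mat_def)
  qed (use W in auto)
  have lower: "- V * W + B * (p \<cdot>\<^sub>m 1\<^sub>m m) = p \<cdot>\<^sub>m B - q \<cdot>\<^sub>m corner_mat m m"
  proof -
    have "- V * W = - (V * W)"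
      using W by (intro uminus_mult_left_mat) auto
    moreover have "B * (p \<cdot>\<^sub>m 1\<^sub>m m) = p \<cdot>\<^sub>m B"
      using mult_smult_distrib[OF B one_carrier_mat, of p] B by simp
    ultimately show ?thesis
      unfolding VW using B by (intro eq_matI) auto
  qed
  have "?M * ?G = four_block_mat (A * 1\<^sub>m n + - U * 0\<^sub>m m n) (A * W + - U * (p \<cdot>\<^sub>m 1\<^sub>m m))
      (- V * 1\<^sub>m n + B * 0\<^sub>m m n) (- V * W + B * (p \<cdot>\<^sub>m 1\<^sub>m m))"
    using A B W by (intro mult_four_block_mat) auto
  also have "A * 1\<^sub>m n + - U * 0\<^sub>m m n = A"
    using A by simp
  also have "- V * 1\<^sub>m n + B * 0\<^sub>m m n = - V"
    using B by simp
  finally have MG: "?M * ?G = four_block_mat A (0\<^sub>m n m) (- V) (p \<cdot>\<^sub>m B - q \<cdot>\<^sub>m corner_mat m m)"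
    unfolding upper lower .
  have "det ?M * p ^ m = det ?M * det ?G"
    using W by (subst det_four_block_mat_lower_left_zero[of _ n]) auto
  also have "\<dots> = det (?M * ?G)"
    using A B W by (intro det_mult[symmetric, of _ "n + m"]) auto
  also have "\<dots> = p * (p ^ (m - 1) * (p * det B - q * det (mat_delete B 0 0)))"
    unfolding MG p_def[symmetric] using A B
    by (subst det_four_block_mat_upper_right_zero[OF A refl]) (auto simp: p_def det_smult_sub_corner[OF B m])
  also have "\<dots> = (p * det B - q * det (mat_delete B 0 0)) * p ^ m"
    using m by (cases m) (simp_all add: algebra_simps)
  \<comment> \<open>The factor \<open>p ^ m\<close> cancels because \<open>p = det A\<close> is
    non-zero in a domain.\<close>
  finally show ?thesis
    using nz by (simp add: p_def q_def U_def V_def)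
qed

section \<open>Recursion for the characteristic polynomials\<close>

definition char_mat :: "btree \<Rightarrow> int poly mat" where
  "char_mat b = weight_matrix (graph_of b) - adjacency_matrix (graph_of b)"

lemma char_mat_carrier [simp]: "char_mat b \<in> carrier_mat (length (wlist b)) (length (wlist b))"
  by (rule carrier_matI) (simp_all add: char_mat_def adjacency_matrix_def num_verts_def)

lemma char_mat_dim [simp]:
  "dim_row (char_mat b) = length (wlist b)" "dim_col (char_mat b) = length (wlist b)"
  using char_mat_carrier[of b] by (simp_all del: char_mat_carrier)

lemma char_mat_index:
  assumes "i < length (wlist b)" "j < length (wlist b)"
  shows "char_mat b $$ (i, j) =
    (if i = j then monom 1 (wlist b ! i) else 0) - (if {i, j} \<in> edge_set b then 1 else 0)"
  using assms by (simp add: char_mat_def weight_matrix_def adjacency_matrix_def num_verts_def)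

lemma edge_set_Join_iff:
  fixes a b :: btree
  defines "n \<equiv> length (wlist a)"
  shows "i < n \<Longrightarrow> j < n \<Longrightarrow> {i, j} \<in> edge_set (Join a b) \<longleftrightarrow> {i, j} \<in> edge_set a"
    and "{i + n, j + n} \<in> edge_set (Join a b) \<longleftrightarrow> {i, j} \<in> edge_set b"
    and "i < n \<Longrightarrow> {i, j + n} \<in> edge_set (Join a b) \<longleftrightarrow> i = 0 \<and> j = 0"
proof -
  have n: "0 < n"
    by (simp add: n_def)
  have no_loop: "{k} \<notin> edge_set c" for k c
    using edge_set_simple[of "{k}" c] by (auto simp: doubleton_eq_iff)
  have wlog: "{i, j} \<in> F \<longleftrightarrow> {i, j} \<in> F'"
    if "\<And>i j. P i \<Longrightarrow> P j \<Longrightarrow> i < j \<Longrightarrow> {i, j} \<in> F \<longleftrightarrow> {i, j} \<in> F'" "P i" "P j" "{i} \<notin> F" "{i} \<notin> F'"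
    for P :: "nat \<Rightarrow> bool" and i j :: nat and F F'
    using that(1)[of i j] that(1)[of j i] that(2-)
    by (cases i j rule: linorder_cases) (auto simp: insert_commute)
  have 1: "{i, j} \<in> edge_set (Join a b) \<longleftrightarrow> {i, j} \<in> edge_set a" if "i < n" "j < n" "i < j" for i j
    using edge_set_Join_cases[of i j a b] that by (auto simp: n_def)
  have shift: "(`) (\<lambda>i. i + n) ` edge_set b \<subseteq> edge_set (Join a b)"
    by (auto simp: n_def)
  have 2: "{i + n, j + n} \<in> edge_set (Join a b) \<longleftrightarrow> {i, j} \<in> edge_set b" if "i < j" for i j
  proof
    assume "{i + n, j + n} \<in> edge_set (Join a b)"
    then show "{i, j} \<in> edge_set b"
      using edge_set_Join_cases[of "i + n" "j + n" a b] that n by (auto simp flip: n_def)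
  next
    assume "{i, j} \<in> edge_set b"
    then have "(\<lambda>i. i + n) ` {i, j} \<in> edge_set (Join a b)"
      using shift by blast
    then show "{i + n, j + n} \<in> edge_set (Join a b)"
      by simp
  qed
  show "{i, j} \<in> edge_set (Join a b) \<longleftrightarrow> {i, j} \<in> edge_set a" if "i < n" "j < n"
    by (rule wlog[of "\<lambda>i. i < n"]) (use 1 that no_loop in blast)+
  show "{i + n, j + n} \<in> edge_set (Join a b) \<longleftrightarrow> {i, j} \<in> edge_set b"
    using 2[of i j] 2[of j i] no_loop[of "i + n" "Join a b"] no_loop[of i b]
    by (cases i j rule: linorder_cases) (auto simp: insert_commute simp del: edge_set.simps)
  show "{i, j + n} \<in> edge_set (Join a b) \<longleftrightarrow> i = 0 \<and> j = 0" if "i < n"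
  proof
    assume "{i, j + n} \<in> edge_set (Join a b)"
    then show "i = 0 \<and> j = 0"
      using edge_set_Join_cases[of i "j + n" a b] that by (auto simp flip: n_def)
  next
    assume "i = 0 \<and> j = 0"
    then show "{i, j + n} \<in> edge_set (Join a b)"
      by (simp add: n_def)
  qed
qed

lemma char_mat_Join:
  fixes a b :: btree
  defines "n \<equiv> length (wlist a)" and "m \<equiv> length (wlist b)"
  shows "char_mat (Join a b) = four_block_mat (char_mat a) (- corner_mat n m) (- corner_mat m n) (char_mat b)"
proof (rule eq_matI)
  fix i j
  assume "i < dim_row (four_block_mat (char_mat a) (- corner_mat n m) (- corner_mat m n) (char_mat b))"
    "j < dim_col (four_block_mat (char_mat a) (- corner_mat n m) (- corner_mat m n) (char_mat b))"
  then have ij: "i < n + m" "j < n + m"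
    by (simp_all add: n_def m_def)
  have nm [simp]: "length (wlist a) = n" "length (wlist b) = m"
    by (simp_all add: n_def m_def)
  note iff = edge_set_Join_iff[of _ a _ b, unfolded nm]
  have J: "char_mat (Join a b) $$ (i, j) = (if i = j then monom 1 ((wlist a @ wlist b) ! i) else 0)
      - (if {i, j} \<in> edge_set (Join a b) then 1 else 0)"
    using ij by (subst char_mat_index) (simp_all del: edge_set.simps)
  consider "i < n" "j < n" | j' where "i < n" "j = j' + n" | i' where "i = i' + n" "j < n"
    | i' j' where "i = i' + n" "j = j' + n"
    by (metis le_add_diff_inverse2 not_le)
  then show "char_mat (Join a b) $$ (i, j)
    = four_block_mat (char_mat a) (- corner_mat n m) (- corner_mat m n) (char_mat b) $$ (i, j)"
  proof cases
    case 1
    then show ?thesis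
      unfolding J iff(1)[OF 1] using ij by (simp add: char_mat_index nth_append)
  next
    case (2 j')
    then show ?thesis
      using J iff(3)[OF 2(1), of j'] ij by (simp add: corner_mat_def del: edge_set.simps)
  next
    case (3 i')
    then have "{i, j} \<in> edge_set (Join a b) \<longleftrightarrow> j = 0 \<and> i' = 0"
      using iff(3)[OF 3(2), of i'] by (simp add: insert_commute del: edge_set.simps)
    then show ?thesis
      unfolding J using 3 ij by (simp add: corner_mat_def del: edge_set.simps)
  next
    case (4 i' j')
    then show ?thesis
      using J iff(2)[of i' j'] ij by (simp add: char_mat_index nth_append del: edge_set.simps)
  qed
qed (simp_all add: n_def m_def)

definition tree_poly :: "btree \<Rightarrow> int poly" where
  "tree_poly b = det (char_mat b)"

definition rootless_poly :: "btree \<Rightarrow> int poly" where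
  "rootless_poly b = det (mat_delete (char_mat b) 0 0)"

lemma weighted_char_poly_graph_of: "weighted_char_poly (graph_of b) = tree_poly b"
  by (simp add: weighted_char_poly_def tree_poly_def char_mat_def)

lemma tree_poly_Vertex: "tree_poly (Vertex k) = monom 1 (Suc k)"
proof -
  have "char_mat (Vertex k) \<in> carrier_mat 1 1"
    using char_mat_carrier[of "Vertex k"] by (simp del: char_mat_carrier)
  then show ?thesis
    unfolding tree_poly_def by (simp add: det_single char_mat_index del: char_mat_carrier)
qed

lemma rootless_poly_Vertex: "rootless_poly (Vertex k) = 1"
  unfolding rootless_poly_def by (rule det_dim_zero, rule carrier_matI) simp_all

text \<open>Removing the root of \<open>a\<close> removes the only edge between the two parts, so
  the matrix becomes block diagonal.\<close>

lemma rootless_poly_Join: "rootless_poly (Join a b) = rootless_poly a * tree_poly b"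
proof -
  let ?n = "length (wlist a)" and ?m = "length (wlist b)"
  have A: "mat_delete (char_mat a) 0 0 \<in> carrier_mat (?n - 1) (?n - 1)"
    by (intro mat_delete_carrier) simp
  obtain n' where n: "?n = Suc n'"
    by (metis gr0_conv_Suc length_wlist_pos)
  have eq: "mat_delete (char_mat (Join a b)) 0 0
    = four_block_mat (mat_delete (char_mat a) 0 0) (0\<^sub>m (?n - 1) ?m) (0\<^sub>m ?m (?n - 1)) (char_mat b)"
    unfolding char_mat_Join by (intro eq_matI) (auto simp: mat_delete_def corner_mat_def n)
  show ?thesis
    unfolding rootless_poly_def tree_poly_def eq
    by (rule det_four_block_mat_upper_right_zero[OF A refl]) auto
qed

lemma tree_poly_Join_aux:
  "tree_poly a \<noteq> 0 \<Longrightarrow> tree_poly (Join a b) = tree_poly a * tree_poly b - rootless_poly a * rootless_poly b"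
  unfolding tree_poly_def rootless_poly_def char_mat_Join by (rule det_joined_blocks) auto

text \<open>Strictness forces \<open>tree_poly b \<noteq> 0\<close>, the condition under which the
  recursion was obtained. In a join the product of the characteristic polynomials has larger degree
  than the term subtracted from it, so no leading term is lost.\<close>

lemma degree_rootless_poly_less: "degree (rootless_poly b) < degree (tree_poly b)"
proof (induction b)
  case (Vertex k)
  then show ?case
    by (simp add: tree_poly_Vertex rootless_poly_Vertex degree_monom_eq)
next
  case (Join a b)
  then have nz: "tree_poly a \<noteq> 0" "tree_poly b \<noteq> 0"
    by auto
  have "degree (rootless_poly a * rootless_poly b) \<le> degree (rootless_poly a) + degree (rootless_poly b)"
    by (rule degree_mult_le)
  also have "\<dots> < degree (tree_poly a * tree_poly b)"
    using Join nz by (simp add: degree_mult_eq)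
  finally have "degree (tree_poly (Join a b)) = degree (tree_poly a * tree_poly b)"
    unfolding tree_poly_Join_aux[OF nz(1)] diff_conv_add_uminus by (intro degree_add_eq_left) simp
  moreover have "degree (rootless_poly (Join a b)) \<le> degree (rootless_poly a) + degree (tree_poly b)"
    unfolding rootless_poly_Join by (rule degree_mult_le)
  ultimately show ?case
    using Join nz by (simp add: degree_mult_eq)
qed

lemma tree_poly_Join: "tree_poly (Join a b) = tree_poly a * tree_poly b - rootless_poly a * rootless_poly b"
  using degree_rootless_poly_less[of a] by (intro tree_poly_Join_aux) auto

lemma weighted_char_poly_iso:
  assumes "weighted_iso G H"
  shows "weighted_char_poly G = weighted_char_poly H"
proof -
  define n where "n = num_verts G"
  obtain f where f: "bij_betw f (verts G) (verts H)"
    and e: "\<And>u v. u \<in> verts G \<Longrightarrow> v \<in> verts G \<Longrightarrow> {u, v} \<in> edges G \<longleftrightarrow> {f u, f v} \<in> edges H"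
    and w: "\<And>v. v \<in> verts G \<Longrightarrow> weights H ! f v = weights G ! v"
    using assms unfolding weighted_iso_def by blast
  have nH: "num_verts H = n"
    using bij_betw_same_card[OF f] by (simp add: verts_def n_def)
  have verts: "verts G = {0..<n}" "verts H = {0..<n}"
    by (simp_all add: verts_def nH n_def)
  \<comment> \<open>Nothing is known about \<open>f\<close> outside \<open>{0..<n}\<close>, whereas
    a permutation of this set must fix all other points.\<close>
  define p where "p i = (if i < n then f i else i)" for i
  have "bij_betw p {0..<n} {0..<n}"
    using f unfolding verts by (subst bij_betw_cong[of _ _ f]) (auto simp: p_def)
  then have p: "p permutes {0..<n}"
    by (rule bij_imp_permutes) (auto simp: p_def)
  have p_less: "p i < n" if "i < n" for i
    using permutes_in_image[OF p, of i] that by simp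
  have pf: "p i = f i" if "i < n" for i
    using that by (simp add: p_def)
  define A where "A = weight_matrix H - adjacency_matrix H"
  have A: "A \<in> carrier_mat n n"
    by (rule carrier_matI) (simp_all add: A_def adjacency_matrix_def nH)
  define B where "B = mat n n (\<lambda>(i, j). A\<^sup>T $$ (p i, j))"
  have "weight_matrix G - adjacency_matrix G = mat n n (\<lambda>(i, j). B\<^sup>T $$ (p i, j))"
  proof (rule eq_matI)
    fix i j assume "i < dim_row (mat n n (\<lambda>(i, j). B\<^sup>T $$ (p i, j)))" "j < dim_col (mat n n (\<lambda>(i, j). B\<^sup>T $$ (p i, j)))"
    then have ij: "i < n" "j < n" by auto
    have "p i = p j \<longleftrightarrow> i = j"
      using permutes_inj[OF p] by (auto simp: inj_def)
    moreover have "weights H ! p i = weights G ! i"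
      using w[of i] ij by (simp add: verts pf)
    moreover have "{p i, p j} \<in> edges H \<longleftrightarrow> {i, j} \<in> edges G"
      using e[of i j] ij by (simp add: verts pf)
    ultimately show "(weight_matrix G - adjacency_matrix G) $$ (i, j) = mat n n (\<lambda>(i, j). B\<^sup>T $$ (p i, j)) $$ (i, j)"
      using ij p_less A
      by (cases "i = j") (simp_all add: B_def A_def weight_matrix_def adjacency_matrix_def nH flip: n_def)
  qed (simp_all add: weight_matrix_def adjacency_matrix_def n_def)
  \<comment> \<open>Rows and, after transposition, columns are permuted in the same way, so the sign
    enters twice and disappears.\<close>
  then have "weighted_char_poly G = signof p * det (B\<^sup>T)"
    unfolding weighted_char_poly_def by (simp add: det_permute_rows[OF _ p] B_def)
  also have "det (B\<^sup>T) = signof p * det (A\<^sup>T)"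
    using det_transpose[of B n] A unfolding B_def by (simp add: det_permute_rows[OF _ p])
  also have "det (A\<^sup>T) = weighted_char_poly H"
    using det_transpose[OF A] by (simp add: A_def weighted_char_poly_def)
  finally show ?thesis
    by (simp add: sign_def)
qed

subsection \<open>Cospectral mates\<close>

definition leg :: "nat \<Rightarrow> nat \<Rightarrow> btree" where
  "leg i j = Join (Vertex i) (Vertex j)"

text \<open>Below a root of weight 1 hang three paths of two vertices.  Their weights, from the root outwards,
  are (3,1), (6,2), (2,6) in \<open>gadget\<close> and (2,2), (7,1), (3,5) in \<open>gadget'\<close>.\<close>

definition gadget :: btree where
  "gadget = Join (Join (Join (Vertex 0) (leg 2 0)) (leg 5 1)) (leg 1 5)"

definition gadget' :: btree where
  "gadget' = Join (Join (Join (Vertex 0) (leg 1 1)) (leg 6 0)) (leg 2 4)"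

text \<open>A path with weights \<open>a\<close>, \<open>b\<close> from the root outwards has the
  pair \<open>x^(a+b) - 1\<close>, \<open>x^b\<close>. The sums \<open>a + b\<close> are 4, 8, 8 in
  both gadgets, so the rootless polynomials agree. The characteristic polynomials agree because the
  quotients \<open>x^b / (x^(a+b) - 1)\<close> have equal sums: both
  \<open>x/(x^4-1) + (x^2+x^6)/(x^8-1)\<close> and \<open>x^2/(x^4-1) + (x+x^5)/(x^8-1)\<close>
  equal \<open>(x+x^2)/(x^4-1)\<close>, by \<open>x^8-1 = (x^4-1)(x^4+1)\<close>.\<close>

lemma gadget_polys:
  "tree_poly gadget = tree_poly gadget'" "rootless_poly gadget = rootless_poly gadget'"
proof -
  define x :: "int poly" where "x = monom 1 1"
  have V: "tree_poly (Vertex k) = x ^ Suc k" for k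
    by (simp only: tree_poly_Vertex x_def monom_power) simp
  note simps = gadget_def gadget'_def leg_def tree_poly_Join rootless_poly_Join rootless_poly_Vertex V
  show "tree_poly gadget = tree_poly gadget'"
    unfolding simps by (simp add: eval_nat_numeral algebra_simps)
  show "rootless_poly gadget = rootless_poly gadget'"
    unfolding simps by (simp add: eval_nat_numeral algebra_simps)
qed

lemma gadget_weights: "mset (wlist gadget) \<noteq> mset (wlist gadget')"
proof
  assume "mset (wlist gadget) = mset (wlist gadget')"
  then have "set (wlist gadget) = set (wlist gadget')"
    by (rule mset_eq_setD)
  then show False
    by (auto simp: gadget_def gadget'_def leg_def)
qed

text \<open>Both polynomials of a join depend on its parts only through their pairs, so equality of
  pairs propagates from the branch up to the root. The change of weights is stated as a balance of
  sums, which avoids subtraction of multisets.\<close>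

lemma exchange_subtree:
  assumes "tree_of l \<in> subtrees t"
    and "tree_poly l = tree_poly l'" "rootless_poly l = rootless_poly l'"
  shows "\<exists>b b'. tree_of b = t \<and> tree_poly b = tree_poly b' \<and> rootless_poly b = rootless_poly b' \<and>
    mset (wlist b) + mset (wlist l') = mset (wlist b') + mset (wlist l)"
  using assms(1)
proof (induction t)
  case (Node k M)
  show ?case
  proof (cases "tree_of l = Node k M")
    case True
    then show ?thesis
      using assms(2,3) by (intro exI[of _ l] exI[of _ l']) (simp add: add.commute)
  next
    case False
    then obtain s where s: "s \<in># M" "tree_of l \<in> subtrees s"
      using Node.prems by auto
    obtain b b' where b: "tree_of b = s" "tree_poly b = tree_poly b'" "rootless_poly b = rootless_poly b'"
      "mset (wlist b) + mset (wlist l') = mset (wlist b') + mset (wlist l)"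
      using Node.IH[OF s] by blast
    obtain M' where M': "M = add_mset s M'"
      using multi_member_split[OF s(1)] by blast
    obtain a where "tree_of a = Node k M'"
      using tree_of_surj by blast
    then show ?thesis
      using b by (intro exI[of _ "Join a b"] exI[of _ "Join a b'"])
        (simp add: M' tree_poly_Join rootless_poly_Join add.assoc)
  qed
qed

lemma mset_weights: "mset (weights G) = image_mset ((!) (weights G)) (mset_set (verts G))"
proof -
  have "mset (map ((!) (weights G)) [0..<length (weights G)]) = image_mset ((!) (weights G)) (mset_set (verts G))"
    unfolding mset_map mset_upt by (simp add: verts_def num_verts_def)
  then show ?thesis
    by (simp only: map_nth)
qed

lemma weighted_iso_mset_weights:
  assumes "weighted_iso G H"
  shows "mset (weights G) = mset (weights H)"
proof -
  obtain f where f: "bij_betw f (verts G) (verts H)"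
    and w: "\<And>v. v \<in> verts G \<Longrightarrow> weights H ! f v = weights G ! v"
    using assms unfolding weighted_iso_def by blast
  have "mset (weights H) = image_mset ((!) (weights H)) (image_mset f (mset_set (verts G)))"
    using f by (simp add: mset_weights image_mset_mset_set bij_betw_def)
  also have "\<dots> = image_mset ((!) (weights G)) (mset_set (verts G))"
    unfolding multiset.map_comp by (rule image_mset_cong) (simp add: w)
  finally show ?thesis
    by (simp add: mset_weights)
qed

lemma weighted_iso_total_weight:
  assumes "weighted_iso G H"
  shows "total_weight G = total_weight H"
proof -
  have "total_weight K = sum_mset (mset (weights K))" for K
    by (simp add: total_weight_def mset_weights sum_unfold_sum_mset del: sum_mset_sum_list)
  then show ?thesis
    using weighted_iso_mset_weights[OF assms] by simp
qed

text \<open>An isomorphism would preserve the multiset of weights; cancelling it from the balance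
  would equate the weights of the two gadgets.\<close>

lemma has_cospectral_mate_of_gadget:
  assumes r: "realizes ((!) (weights G)) (verts G) (edges G) v t"
    and g: "tree_of gadget \<in> subtrees t"
  shows "has_cospectral_mate G"
proof -
  obtain b b' where b: "tree_of b = t" "tree_poly b = tree_poly b'"
    and ms: "mset (wlist b) + mset (wlist gadget') = mset (wlist b') + mset (wlist gadget)"
    using exchange_subtree[OF g gadget_polys] by blast
  have iso: "weighted_iso (graph_of b) G"
    using r b(1) by (intro weighted_iso_graph_of) simp
  have "\<not> weighted_iso G (graph_of b')"
  proof
    assume "weighted_iso G (graph_of b')"
    then have "mset (wlist b) = mset (wlist b')"
      using weighted_iso_mset_weights[OF weighted_iso_trans[OF iso]] by simp
    then show False
      using ms gadget_weights by simp
  qed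
  moreover have "weighted_cospectral G (graph_of b')"
    using weighted_char_poly_iso[OF iso] b(2) by (simp add: weighted_cospectral_def weighted_char_poly_graph_of)
  ultimately show ?thesis
    unfolding has_cospectral_mate_def using weighted_tree_graph_of by blast
qed

section \<open>Counting isomorphism classes\<close>

lemma weighted_iso_of_common_tree:
  assumes "realizes ((!) (weights G)) (verts G) (edges G) v t"
    and "realizes ((!) (weights H)) (verts H) (edges H) v' t"
  shows "weighted_iso G H"
proof -
  obtain b where b: "tree_of b = t"
    using tree_of_surj by blast
  have "weighted_iso (graph_of b) G"
    using assms(1) by (intro weighted_iso_graph_of) (simp add: b)
  moreover have "weighted_iso (graph_of b) H"
    using assms(2) by (intro weighted_iso_graph_of) (simp add: b)
  ultimately show ?thesis
    by (rule weighted_iso_trans[OF weighted_iso_sym])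
qed

lemma tree_classesD:
  assumes "C \<in> tree_classes n" "T \<in> C"
  shows "weighted_tree T" "total_weight T = n" "C = tree_iso_rel `` {T}"
proof -
  obtain T0 where T0: "weighted_tree T0" "total_weight T0 = n" "C = tree_iso_rel `` {T0}"
    using assms(1) by (auto simp: tree_classes_def quotient_def)
  then have rel: "(T0, T) \<in> tree_iso_rel"
    using assms(2) by simp
  then show "weighted_tree T"
    by (simp add: tree_iso_rel_def)
  show "total_weight T = n"
    using rel T0(2) weighted_iso_total_weight[of T0 T] by (simp add: tree_iso_rel_def)
  show "C = tree_iso_rel `` {T}"
    using equiv_class_eq[OF equiv_tree_iso_rel rel] T0(3) by simp
qed

lemma tree_classes_nonempty_class: "C \<in> tree_classes n \<Longrightarrow> \<exists>T. T \<in> C"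
  by (auto simp: tree_classes_def quotient_def tree_iso_rel_def intro: weighted_iso_refl)

lemma weighted_tree_0_in_verts: "weighted_tree G \<Longrightarrow> 0 \<in> verts G"
  by (auto simp: weighted_tree_def connected_graph_def verts_def)

text \<open>Rooting some member of each class at its vertex 0 assigns to the class a rooted tree
  that determines it. A class without mates receives a tree in which the gadget is not a
  branch.\<close>

lemma card_mateless_classes_le:
  "card {C \<in> tree_classes n. \<not> (\<exists>T\<in>C. has_cospectral_mate T)} \<le> cnt {t. tree_of gadget \<notin> subtrees t} n"
    (is "card ?bad \<le> _")
proof -
  define P where "P C t \<longleftrightarrow> (\<exists>T\<in>C. realizes ((!) (weights T)) (verts T) (edges T) 0 t)" for C t
  define g where "g C = (SOME t. P C t)" for C
  have ex: "P C (g C)" if C: "C \<in> tree_classes n" for C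
  proof -
    obtain T where T: "T \<in> C"
      using tree_classes_nonempty_class[OF C] by blast
    then have "weighted_tree T"
      using tree_classesD(1)[OF C] by blast
    then obtain t where "realizes ((!) (weights T)) (verts T) (edges T) 0 t"
      using weighted_tree_realizes weighted_tree_0_in_verts by blast
    then have "P C t"
      using T by (auto simp: P_def)
    then show ?thesis
      unfolding g_def by (rule someI)
  qed
  have "inj_on g ?bad"
  proof (rule inj_onI)
    fix C C' assume "C \<in> ?bad" "C' \<in> ?bad" and eq: "g C = g C'"
    then have C: "C \<in> tree_classes n" "C' \<in> tree_classes n"
      by auto
    obtain T where T: "T \<in> C" "realizes ((!) (weights T)) (verts T) (edges T) 0 (g C)"
      using ex[OF C(1)] by (auto simp: P_def)
    obtain T' where T': "T' \<in> C'" "realizes ((!) (weights T')) (verts T') (edges T') 0 (g C)"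
      using ex[OF C(2)] by (auto simp: P_def eq)
    have "(T, T') \<in> tree_iso_rel"
      using weighted_iso_of_common_tree[OF T(2) T'(2)] tree_classesD(1)[OF C(1) T(1)]
        tree_classesD(1)[OF C(2) T'(1)] by (simp add: tree_iso_rel_def)
    then show "C = C'"
      using tree_classesD(3)[OF C(1) T(1)] tree_classesD(3)[OF C(2) T'(1)]
        equiv_class_eq[OF equiv_tree_iso_rel] by simp
  qed
  moreover have "g ` ?bad \<subseteq> {t \<in> {t. tree_of gadget \<notin> subtrees t}. wt t = n}"
  proof
    fix t assume "t \<in> g ` ?bad"
    then obtain C where C: "C \<in> tree_classes n" "\<not> (\<exists>T\<in>C. has_cospectral_mate T)" "t = g C"
      by blast
    obtain T where T: "T \<in> C" "realizes ((!) (weights T)) (verts T) (edges T) 0 t"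
      using ex[OF C(1)] C(3) by (auto simp: P_def)
    have "tree_of gadget \<notin> subtrees t"
      using has_cospectral_mate_of_gadget[OF T(2)] C(2) T(1) by blast
    moreover have "wt t = n"
      using total_weight_realizes[OF T(2)] tree_classesD(2)[OF C(1) T(1)] by simp
    ultimately show "t \<in> {t \<in> {t. tree_of gadget \<notin> subtrees t}. wt t = n}"
      by blast
  qed
  ultimately show ?thesis
    unfolding cnt_def by (intro card_inj_on_le[of g] finite_wt_eq)
qed

lemma card_verts_le: "weighted_tree G \<Longrightarrow> card (verts G) \<le> total_weight G"
proof -
  assume "weighted_tree G"
  then have "(\<Sum>v\<in>verts G. 1) \<le> total_weight G"
    unfolding total_weight_def weighted_tree_def by (intro sum_mono) (auto simp: Suc_le_eq)
  then show ?thesis by simp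
qed

text \<open>Every rooted tree is the unfolding of the representative of its class at some vertex,
  and a tree of total weight \<open>n\<close> has at most \<open>n\<close> vertices because all
  weights are positive.\<close>

lemma cnt_UNIV_le_classes: "cnt UNIV n \<le> card (tree_classes n) * n"
proof -
  define rep where "rep C = (SOME T. T \<in> C)" for C :: "weighted_graph set"
  have rep: "rep C \<in> C" if "C \<in> tree_classes n" for C
    unfolding rep_def using tree_classes_nonempty_class[OF that] by (rule someI_ex)
  define U where "U C = (\<lambda>v. unfold_tree ((!) (weights (rep C))) (edges (rep C))
    (Suc (card (verts (rep C)))) v v) ` verts (rep C)" for C
  have "t \<in> (\<Union>C\<in>tree_classes n. U C)" if "wt t = n" for t
  proof -
    obtain b where b: "tree_of b = t"
      using tree_of_surj by blast
    define C where "C = tree_iso_rel `` {graph_of b}"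
    have C: "C \<in> tree_classes n"
      unfolding C_def tree_classes_def using b that weighted_tree_graph_of total_weight_graph_of
      by (intro quotientI) simp
    have "(graph_of b, rep C) \<in> tree_iso_rel"
      using rep[OF C] by (simp add: C_def)
    then obtain v where "v \<in> verts (rep C)"
      "realizes ((!) (weights (rep C))) (verts (rep C)) (edges (rep C)) v t"
      using realizes_weighted_iso[of "graph_of b" "rep C" 0 t] graph_of_realizes[of b] b
      by (auto simp: tree_iso_rel_def)
    then have "t \<in> U C"
      unfolding U_def using realizes_unfold_tree by (intro image_eqI)
    then show ?thesis
      using C by blast
  qed
  then have "{t \<in> UNIV. wt t = n} \<subseteq> (\<Union>C\<in>tree_classes n. U C)"
    by blast
  then have "cnt UNIV n \<le> card (\<Union>C\<in>tree_classes n. U C)"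
    unfolding cnt_def by (intro card_mono finite_UN_I finite_tree_classes) (auto simp: U_def)
  also have "\<dots> \<le> (\<Sum>C\<in>tree_classes n. card (U C))"
    by (rule card_UN_le[OF finite_tree_classes])
  also have "\<dots> \<le> (\<Sum>C\<in>tree_classes n. n)"
  proof (rule sum_mono)
    fix C assume C: "C \<in> tree_classes n"
    have "card (U C) \<le> card (verts (rep C))"
      unfolding U_def by (intro card_image_le) simp
    also have "\<dots> \<le> n"
      using card_verts_le tree_classesD(1,2)[OF C rep[OF C]] by metis
    finally show "card (U C) \<le> n" .
  qed
  finally show ?thesis by simp
qed

theorem theorem8p6:
  shows "(\<lambda>n. real (card {C \<in> tree_classes n. \<exists>T\<in>C. has_cospectral_mate T})
              / real (card (tree_classes n))) \<longlonglongrightarrow> 1"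
proof -
  define c where "c n = real (card (tree_classes n))" for n
  define good where "good n = real (card {C \<in> tree_classes n. \<exists>T\<in>C. has_cospectral_mate T})" for n
  define bad where "bad n = real (card {C \<in> tree_classes n. \<not> (\<exists>T\<in>C. has_cospectral_mate T)})" for n
  define s where "s n = real (cnt {t. tree_of gadget \<notin> subtrees t} n)" for n
  define r where "r n = real (cnt UNIV n)" for n
  have c_pos: "0 < c n" if "0 < n" for n
    using tree_classes_nonempty[OF that] finite_tree_classes by (auto simp: c_def card_gt_0_iff)
  have split: "c n = good n + bad n" for n
  proof -
    have "tree_classes n = {C \<in> tree_classes n. \<exists>T\<in>C. has_cospectral_mate T}
        \<union> {C \<in> tree_classes n. \<not> (\<exists>T\<in>C. has_cospectral_mate T)}"
      by blast
    then have "card (tree_classes n) = card {C \<in> tree_classes n. \<exists>T\<in>C. has_cospectral_mate T}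
        + card {C \<in> tree_classes n. \<not> (\<exists>T\<in>C. has_cospectral_mate T)}"
      using finite_tree_classes by (subst card_Un_disjoint[symmetric]) auto
    then show ?thesis
      by (simp add: c_def good_def bad_def)
  qed
  \<comment> \<open>The mateless classes number at most \<open>s n\<close>, while there are at least
    \<open>r n / n\<close> classes in all; this is where the factor \<open>n\<close> arises.\<close>
  have le: "norm (bad n / c n) \<le> real n * s n / r n" if n: "1 \<le> n" for n
  proof -
    have pos: "0 < r n" "0 < c n"
      using cnt_UNIV_pos[of n] c_pos[of n] n by (simp_all add: r_def)
    have "r n \<le> c n * real n"
      using cnt_UNIV_le_classes[of n] unfolding r_def c_def by (simp flip: of_nat_mult)
    moreover have "bad n \<le> s n"
      using card_mateless_classes_le[of n] by (simp add: bad_def s_def)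
    ultimately have "bad n * r n \<le> s n * (c n * real n)"
      using pos by (intro mult_mono) (auto simp: s_def)
    then have "bad n / c n \<le> real n * s n / r n"
      using pos by (simp add: field_simps)
    moreover have "0 \<le> bad n / c n"
      using pos by (simp add: bad_def)
    ultimately show ?thesis by simp
  qed
  have "(\<lambda>n. bad n / c n) \<longlonglongrightarrow> 0"
  proof (rule Lim_null_comparison)
    show "\<forall>\<^sub>F n in sequentially. norm (bad n / c n) \<le> real n * s n / r n"
      using le by (rule eventually_sequentiallyI)
    show "(\<lambda>n. real n * s n / r n) \<longlonglongrightarrow> 0"
      unfolding s_def r_def by (rule omission_negligible)
  qed
  then have "(\<lambda>n. 1 - bad n / c n) \<longlonglongrightarrow> 1 - 0"
    by (intro tendsto_intros)
  \<comment> \<open>At \<open>n = 0\<close> there are no classes and both quotients are 0 by the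
    convention for division by 0, so the equation starts at 1.\<close>
  moreover have "\<forall>\<^sub>F n in sequentially. 1 - bad n / c n = good n / c n"
  proof (rule eventually_sequentiallyI[of 1])
    fix n :: nat assume "1 \<le> n"
    then show "1 - bad n / c n = good n / c n"
      using c_pos[of n] split[of n] by (simp add: field_simps)
  qed
  ultimately have "(\<lambda>n. good n / c n) \<longlonglongrightarrow> 1"
    using tendsto_cong by fastforce
  then show ?thesis
    unfolding good_def c_def .
qed

end
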